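(* Let $k_{\max}:=K'(0)+\int_0^{\Phi_F}(K''(\phi))_+\,d\phi$. Suppose $k_{\max}<0$ and $$\int_0^{\Phi_F}\frac1{K(\phi)}\,d\phi>1 .$$ Suppose $Q_{\mathrm{init}}\in C^1[0,1]$ is non-decreasing, $Q_{\mathrm{init}}(0)=0$, $Q_{\mathrm{init}}(1)=\Phi_F$, $$\frac{d}{d\eta}Q_{\mathrm{init}}(1)>K(\Phi_F),\qquad \frac{d}{d\eta}Q_{\mathrm{init}}(1)-\frac{d}{d\eta}Q_{\mathrm{init}}(0)=K(\Phi_F)-K(0),$$ and $$\frac{d}{d\eta}Q_{\mathrm{init}}(\eta)-K(Q_{\mathrm{init}}(\eta))>0\qquad\forall\eta\in[0,1].$$ Then there exists a unique global classical solution $(Q,N)$ (i.e. on $[0,+\infty)$) of system (S) with initial datum $Q_{\mathrm{init}}$, and it converges exponentially to the unique steady state $Q^*$ of (S) in the sense that, for all $\tau\ge0$, $$\|\partial_\eta Q(\tau,\cdot)-\partial_\eta Q^*(\cdot)\|_{L^1(0,1)}\le e^{k_{\max}\tau}\|\partial_\eta Q(0,\cdot)-\partial_\eta Q^*(\cdot)\|_{L^1(0,1)} .$$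
   Context: Standing assumptions: $\Phi_F>0$ is fixed and $K\in C^2(\mathbb{R})$ is a function with $K',K''$ bounded on $\mathbb{R}$ and $K(\phi)>0$ for $\phi\in[0,\Phi_F]$. Notation: $(x)_+:=\max(x,0)$. System (S), for unknowns $Q(\tau,\eta)$ and $N(\tau)$: $$\partial_\tau Q+\partial_\eta Q=\frac1{N(\tau)}+K(Q)\quad(\tau>0,\ \eta\in(0,1)),\qquad Q(\tau,0)=0\quad(\tau>0),$$ $$\frac1{N(\tau)}=\partial_\eta Q(\tau,1)-K(\Phi_F)\quad(\tau>0),\qquad Q(0,\eta)=Q_{\mathrm{init}}(\eta)\quad(\eta\in[0,1]).$$ Classical solution: given $0<T\le+\infty$ and an initial datum $Q_{\mathrm{init}}\in C^1[0,1]$ that is increasing with $Q_{\mathrm{init}}(0)=0$, $Q_{\mathrm{init}}(1)=\Phi_F$ and $\frac{d}{d\eta}Q_{\mathrm{init}}(1)>K(\Phi_F)$, a pair $(Q,N)$ is a classical solution of (S) on $[0,T)$ if (1) $Q\in C^1([0,T)\times[0,1])$ is increasing in $\eta$ and $N\in C[0,T)$ is positive; (2) the equations of (S) hold in the classical sense for $\tau\in[0,T)$; (3) $K(\Phi_F)<\partial_\eta Q(\tau,1)<+\infty$ for all $\tau\in[0,T)$. Here "increasing" means non-decreasing. A steady state of (S) is a time-independent classical solution, i.e. $(Q^*,N^* )$ with $Q^*\in C^1[0,1]$, $N^*\in(0,+\infty)$, $\frac{d}{d\eta}Q^*=K(Q^* )+\frac1{N^*}$ on $[0,1]$, $Q^*(0)=0$,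 $Q^*(1)=\Phi_F$. Under the condition $\int_0^{\Phi_F}\frac{1}{K}\,d\phi>1$ there is exactly one steady state. *)

theory Defs
  imports "HOL-Analysis.Analysis"
begin

text \<open>Derivatives at the endpoints of an interval are one-sided, hence \<open>at x within S\<close>.\<close>

abbreviation deriv_within :: "(real \<Rightarrow> real) \<Rightarrow> real set \<Rightarrow> real \<Rightarrow> real"
  where "deriv_within f S x \<equiv> vector_derivative f (at x within S)"

definition C1_on :: "real set \<Rightarrow> (real \<Rightarrow> real) \<Rightarrow> bool"
  where "C1_on S f \<longleftrightarrow> f differentiable_on S \<and> continuous_on S (deriv_within f S)"

definition C2_real :: "(real \<Rightarrow> real) \<Rightarrow> bool"
  where "C2_real K \<longleftrightarrow> K differentiable_on UNIV \<and> deriv K differentiable_on UNIV \<and>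
    continuous_on UNIV (deriv (deriv K))"

definition time_interval :: "ereal \<Rightarrow> real set"
  where "time_interval T = {t. 0 \<le> t \<and> ereal t < T}"

definition d_tau :: "ereal \<Rightarrow> (real \<Rightarrow> real \<Rightarrow> real) \<Rightarrow> real \<Rightarrow> real \<Rightarrow> real"
  where "d_tau T Q \<tau> \<eta> = deriv_within (\<lambda>t. Q t \<eta>) (time_interval T) \<tau>"

definition d_eta :: "(real \<Rightarrow> real \<Rightarrow> real) \<Rightarrow> real \<Rightarrow> real \<Rightarrow> real"
  where "d_eta Q \<tau> \<eta> = deriv_within (Q \<tau>) {0..1} \<eta>"

text \<open>\<open>C\<^sup>1([0,T) \<times> [0,1])\<close>: both partial derivatives exist up to the boundary of the strip (one-sided
  there) and are jointly continuous. Differentiability is required explicitly because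
  \<^const>\<open>vector_derivative\<close> is total.\<close>

definition C1_strip :: "ereal \<Rightarrow> (real \<Rightarrow> real \<Rightarrow> real) \<Rightarrow> bool"
  where "C1_strip T Q \<longleftrightarrow>
    (\<forall>\<eta>\<in>{0..1}. (\<lambda>t. Q t \<eta>) differentiable_on time_interval T) \<and>
    (\<forall>\<tau>\<in>time_interval T. Q \<tau> differentiable_on {0..1}) \<and>
    continuous_on (time_interval T \<times> {0..1}) (\<lambda>(\<tau>, \<eta>). d_tau T Q \<tau> \<eta>) \<and>
    continuous_on (time_interval T \<times> {0..1}) (\<lambda>(\<tau>, \<eta>). d_eta Q \<tau> \<eta>)"

text \<open>Classical solutions of (S) on \<open>[0,T)\<close>. The equations are imposed also at \<open>\<tau> = 0\<close>. The bound
  \<open>\<partial>\<^sub>\<eta>Q(\<tau>,1) < \<infinity>\<close> is automatic for real-valued derivatives.\<close>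

definition classical_solution ::
    "(real \<Rightarrow> real) \<Rightarrow> real \<Rightarrow> (real \<Rightarrow> real) \<Rightarrow> ereal \<Rightarrow> (real \<Rightarrow> real \<Rightarrow> real) \<Rightarrow> (real \<Rightarrow> real) \<Rightarrow> bool"
  where "classical_solution K \<Phi>F Qinit T Q N \<longleftrightarrow>
    C1_strip T Q \<and>
    (\<forall>\<tau>\<in>time_interval T. mono_on {0..1} (Q \<tau>)) \<and>
    continuous_on (time_interval T) N \<and>
    (\<forall>\<tau>\<in>time_interval T. N \<tau> > 0) \<and>
    (\<forall>\<tau>\<in>time_interval T. \<forall>\<eta>\<in>{0<..<1}. d_tau T Q \<tau> \<eta> + d_eta Q \<tau> \<eta> = 1 / N \<tau> + K (Q \<tau> \<eta>)) \<and>
    (\<forall>\<tau>\<in>time_interval T. Q \<tau> 0 = 0) \<and>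
    (\<forall>\<tau>\<in>time_interval T. 1 / N \<tau> = d_eta Q \<tau> 1 - K \<Phi>F) \<and>
    (\<forall>\<eta>\<in>{0..1}. Q 0 \<eta> = Qinit \<eta>) \<and>
    (\<forall>\<tau>\<in>time_interval T. K \<Phi>F < d_eta Q \<tau> 1)"

definition steady_state :: "(real \<Rightarrow> real) \<Rightarrow> real \<Rightarrow> (real \<Rightarrow> real) \<Rightarrow> real \<Rightarrow> bool"
  where "steady_state K \<Phi>F Qs Ns \<longleftrightarrow>
    C1_on {0..1} Qs \<and> Ns > 0 \<and>
    (\<forall>\<eta>\<in>{0..1}. deriv_within Qs {0..1} \<eta> = K (Qs \<eta>) + 1 / Ns) \<and>
    Qs 0 = 0 \<and> Qs 1 = \<Phi>F"

definition k_max :: "(real \<Rightarrow> real) \<Rightarrow> real \<Rightarrow> real"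
  where "k_max K \<Phi>F = deriv K 0 + integral {0..\<Phi>F} (\<lambda>\<phi>. max (deriv (deriv K) \<phi>) 0)"

definition L1_norm :: "(real \<Rightarrow> real) \<Rightarrow> real"
  where "L1_norm f = (LINT \<eta>:{0<..<1}|lborel. \<bar>f \<eta>\<bar>)"

end

theory Submission
  imports Defs
begin

text \<open>Write \<open>u = \<partial>\<^sub>\<eta>Q\<close>. Differentiating the equation removes \<open>N\<close>: \<open>u\<close> satisfies \<open>u\<^sub>t + u\<^sub>x = K'(Q) u\<close> with
  \<open>Q(t,x) = \<integral>\<^sub>0\<^sup>x u(t,y) dy\<close>, and the boundary condition together with the equation for \<open>N\<close> says that the
  jump \<open>u(t,1) - u(t,0) = K(P) - K(0)\<close> is constant, where \<open>P = \<Phi>\<^sub>F\<close>. So, up to a jump that is the same for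
  all solutions, \<open>u\<close> is transported on a circle. Classical solutions correspond to nonnegative
  solutions \<open>u\<close> of this problem with \<open>K(P) < u(t,1)\<close> (\<open>classical_solution_of_slope\<close>,
  \<open>slope_of_classical_solution\<close>); that \<open>Q(t,1)\<close> keeps the value \<open>P\<close> follows because \<open>P\<close> is an equilibrium of
  the equation \<open>q' = K(q) - K(P)\<close> for \<open>q(t) = Q(t,1)\<close>.

  Contraction (\<open>slope_L1_contraction\<close>). For the difference \<open>v\<close> of two solutions, transport preserves the
  \<open>L\<^sup>1\<close> norm, and the reaction contributes \<open>\<integral> sgn v (K'(Q\<^sub>1) u\<^sub>1 - K'(Q\<^sub>2) u\<^sub>2)\<close>. On \<open>[0,P]\<close> one has
  \<open>K' = k_max - A - B\<close> with \<open>A\<close> nonnegative and decreasing and \<open>B\<close> nonnegative and increasing.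
  For a primitive \<open>a\<close> of \<open>A\<close> put \<open>E = a(Q\<^sub>1) - a(Q\<^sub>2)\<close>; then \<open>A(Q\<^sub>1) u\<^sub>1 - A(Q\<^sub>2) u\<^sub>2\<close> is \<open>E'\<close>, and monotonicity allows
  \<open>sgn v\<close> to be replaced by \<open>sgn E\<close> at the cost of an inequality. As \<open>E\<close> vanishes at both ends,
  \<open>\<integral> sgn E E' = 0\<close>. The same works for \<open>B\<close>, and \<open>k_max\<close> times the \<open>L\<^sup>1\<close> norm is left. This comparison needs
  no relation between the initial data, so it gives the uniqueness of the solution, and also the
  decay estimate and the uniqueness of the steady state, because a steady state is a classical
  solution that is constant in time.

  Existence (\<open>slope_solution_exists\<close>). A fixed point argument in a weighted sup norm solves the problem
  for all times, with \<open>u\<close> clipped to \<open>[0,C]\<close> in the reaction. The excess \<open>W = u - K(Q)\<close>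
  satisfies \<open>W\<^sub>t + W\<^sub>x = K'(Q) (W - W(t,0))\<close> and takes the same value at both ends. Since \<open>K' \<le> k_max < 0\<close> on \<open>[0,P]\<close>, the
  minimum and the maximum of \<open>W\<close> on the initial line bound \<open>W\<close> for all times. Hence \<open>u\<close> stays
  strictly between \<open>0\<close> and \<open>C\<close>, the clipping never acts, and \<open>1 / N = W(t,1)\<close> stays positive. The steady
  state is obtained by separating variables (\<open>steady_state_exists\<close>).\<close>

section \<open>One-variable calculus\<close>

text \<open>A continuous function with nonpositive lower left Dini derivative does not increase: go back
  from the right endpoint as long as the slope of the chord stays below \<open>\<epsilon>\<close>; the infimum of
  the points that are reached cannot be positive.\<close>

lemma left_dini_nonincreasing:
  fixes F :: "real \<Rightarrow> real"
  assumes T: "0 \<le> T" and cont: "continuous_on {0..T} F"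
    and step: "\<And>t e. 0 < t \<Longrightarrow> t \<le> T \<Longrightarrow> 0 < e \<Longrightarrow> \<exists>h. 0 < h \<and> h \<le> t \<and> F t - F (t - h) \<le> h * e"
  shows "F T \<le> F 0"
proof (rule field_le_epsilon)
  fix e' :: real assume "e' > 0"
  define e where "e = e' / (T + 1)"
  have e: "e > 0" using \<open>e' > 0\<close> T by (simp add: e_def)
  define S where "S = {t\<in>{0..T}. F T - F t \<le> e * (T - t)}"
  have "closed S"
    unfolding S_def using cont by (intro continuous_on_closed_Collect_le) (auto intro!: continuous_intros)
  have "T \<in> S" using T by (auto simp: S_def)
  have bdd: "bdd_below S" by (auto simp: S_def bdd_below_def)
  define s where "s = Inf S"
  have sS: "s \<in> S"
    unfolding s_def using \<open>T \<in> S\<close> \<open>closed S\<close> bdd by (intro closed_contains_Inf) auto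
  have "s = 0"
  proof (rule ccontr)
    assume "s \<noteq> 0"
    with sS have "0 < s" "s \<le> T" by (auto simp: S_def)
    from step[OF this e] obtain h where h: "0 < h" "h \<le> s" "F s - F (s - h) \<le> h * e" by auto
    with sS have "s - h \<in> S" by (auto simp: S_def algebra_simps)
    then have "s \<le> s - h" unfolding s_def using bdd by (intro cInf_lower) auto
    with h show False by simp
  qed
  with sS have "F T - F 0 \<le> e * T" by (auto simp: S_def)
  also have "e * T \<le> e'" using T \<open>e' > 0\<close> by (simp add: e_def field_simps)
  finally show "F T \<le> F 0 + e'" by simp
qed

lemma left_dini_exponential_bound:
  fixes F :: "real \<Rightarrow> real" and k T :: real
  assumes T: "0 \<le> T" and cont: "continuous_on {0..T} F"
    and step: "\<And>t e. 0 < t \<Longrightarrow> t \<le> T \<Longrightarrow> 0 < e \<Longrightarrow>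
        eventually (\<lambda>h. F t - F (t - h) \<le> h * (k * F t + e)) (at_right 0)"
  shows "F T \<le> exp (k * T) * F 0"
proof -
  define G where "G t = exp (- k * t) * F t" for t
  have "G T \<le> G 0"
  proof (rule left_dini_nonincreasing[OF T])
    show "continuous_on {0..T} G"
      unfolding G_def using cont by (intro continuous_intros)
    fix t e :: real assume t: "0 < t" "t \<le> T" and e: "0 < e"
    define e1 where "e1 = e * exp (k * t) / 2"
    have e1: "e1 > 0" using e by (simp add: e1_def)
    have left: "((\<lambda>h. F (t - h)) \<longlongrightarrow> F t) (at_right 0)"
    proof -
      have "(F \<longlongrightarrow> F t) (at t within {0..T})"
        using cont t by (auto simp: continuous_on_def)
      moreover have "filterlim (\<lambda>h. t - h) (at t within {0..T}) (at_right 0)"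
        unfolding filterlim_at
      proof (intro conjI)
        show "((\<lambda>h. t - h) \<longlongrightarrow> t) (at_right 0)" by (auto intro!: tendsto_eq_intros)
        show "\<forall>\<^sub>F h in at_right 0. t - h \<in> {0..T} \<and> t - h \<noteq> t"
          unfolding eventually_at_right_field using t by (intro exI[of _ t]) auto
      qed
      ultimately show ?thesis by (rule filterlim_compose)
    qed
    have "((\<lambda>h. (exp (k * h) - 1) / h) \<longlongrightarrow> k) (at_right 0)"
    proof -
      have "((\<lambda>h. exp (k * h)) has_real_derivative k) (at 0)"
        by (auto intro!: derivative_eq_intros)
      then show ?thesis
        unfolding has_field_derivative_iff by (simp add: filterlim_at_split)
    qed
    from tendsto_mult[OF this left]
    have "((\<lambda>h. (exp (k * h) - 1) / h * F (t - h)) \<longlongrightarrow> k * F t) (at_right 0)" .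
    then have "\<forall>\<^sub>F h in at_right 0. (exp (k * h) - 1) / h * F (t - h) > k * F t - e1"
      using e1 by (intro order_tendstoD) auto
    moreover have "\<forall>\<^sub>F h in at_right 0. F t - F (t - h) \<le> h * (k * F t + e1)"
      using step[OF t e1] .
    moreover have "\<forall>\<^sub>F h in at_right (0::real). 0 < h \<and> h < t"
      unfolding eventually_at_right_field using t by (intro exI[of _ t]) auto
    ultimately have "\<forall>\<^sub>F h in at_right 0. 0 < h \<and> h < t \<and> G t - G (t - h) \<le> h * e"
    proof eventually_elim
      case (elim h)
      then have "0 < h" by simp
      have a: "(exp (k * h) - 1) * F (t - h) \<ge> h * (k * F t - e1)"
        using elim(1) \<open>0 < h\<close> by (simp add: field_simps)
      have "F t - exp (k * h) * F (t - h) = F t - F (t - h) - (exp (k * h) - 1) * F (t - h)"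
        by (simp add: algebra_simps)
      also have "\<dots> \<le> h * (k * F t + e1) - h * (k * F t - e1)"
        using elim(2) a by linarith
      also have "\<dots> = h * (e * exp (k * t))" by (simp add: e1_def algebra_simps)
      finally have b: "F t - exp (k * h) * F (t - h) \<le> h * (e * exp (k * t))" .
      have "G t - G (t - h) = exp (- k * t) * (F t - exp (k * h) * F (t - h))"
        by (simp add: G_def algebra_simps flip: exp_add)
      also have "\<dots> \<le> exp (- k * t) * (h * (e * exp (k * t)))"
        using b by (intro mult_left_mono) auto
      also have "\<dots> = h * e" by (simp add: algebra_simps flip: exp_add)
      finally show ?case using elim(3) by auto
    qed
    then obtain h where "0 < h \<and> h < t \<and> G t - G (t - h) \<le> h * e"
      using eventually_happens'[OF trivial_limit_at_right_real] by blast
    then show "\<exists>h. 0 < h \<and> h \<le> t \<and> G t - G (t - h) \<le> h * e"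
      by (intro exI[of _ h]) auto
  qed
  then have "exp (k * T) * (exp (- k * T) * F T) \<le> exp (k * T) * F 0"
    unfolding G_def by (intro mult_left_mono) auto
  then show ?thesis by (simp add: mult.assoc[symmetric] flip: exp_add)
qed

lemma has_real_integral_derivative:
  fixes f :: "real \<Rightarrow> real"
  assumes "a \<le> b" "\<And>x. x \<in> {a..b} \<Longrightarrow> (f has_real_derivative f' x) (at x within {a..b})"
  shows "(f' has_integral (f b - f a)) {a..b}"
  using assms by (intro fundamental_theorem_of_calculus)
    (auto simp flip: has_real_derivative_iff_has_vector_derivative)

lemma integral_rescale:
  fixes f :: "real \<Rightarrow> real"
  assumes "0 \<le> m" and f: "continuous_on {0..m} f"
  shows "integral {0..m} f = m * integral {0..1} (\<lambda>r. f (m * r))"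
proof -
  have "((\<lambda>r. f (m * r) * m) has_integral
      (integral {0..m * 1} f - integral {0..m * 0} f)) {0..1}"
  proof (rule has_real_integral_derivative)
    fix r :: real assume r: "r \<in> {0..1}"
    then have mr: "m * r \<in> {0..m}" using \<open>0 \<le> m\<close> by (auto intro: mult_left_le)
    have "((\<lambda>r. integral {0..r} f) has_real_derivative f (m * r)) (at (m * r) within {0..m})"
      using integral_has_real_derivative[OF f mr] .
    moreover have "(\<lambda>r. m * r) ` {0..1} \<subseteq> {0..m}" using \<open>0 \<le> m\<close> by (auto intro: mult_left_le)
    ultimately have "((\<lambda>r. integral {0..r} f) has_real_derivative f (m * r)) (at (m * r) within (\<lambda>r. m * r) ` {0..1})"
      by (rule DERIV_subset)
    moreover have "((\<lambda>r. m * r) has_real_derivative m) (at r within {0..1})"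
      by (auto intro!: derivative_eq_intros)
    ultimately have "((\<lambda>r. integral {0..r} f) \<circ> (\<lambda>r. m * r) has_real_derivative f (m * r) * m) (at r within {0..1})"
      by (rule DERIV_image_chain)
    then show "((\<lambda>r. integral {0..m * r} f) has_real_derivative f (m * r) * m) (at r within {0..1})"
      by (simp add: comp_def)
  qed simp
  then have "integral {0..1} (\<lambda>r. f (m * r) * m) = integral {0..m} f"
    by (auto dest: integral_unique)
  then show ?thesis by (simp add: mult.commute)
qed

lemma continuous_on_integral_upper_limit:
  fixes f :: "'a::metric_space \<Rightarrow> real \<Rightarrow> real" and m :: "'a \<Rightarrow> real"
  assumes m: "continuous_on A m" "\<And>p. p \<in> A \<Longrightarrow> 0 \<le> m p"
    and f: "continuous_on {(p, s). p \<in> A \<and> 0 \<le> s \<and> s \<le> m p} (\<lambda>(p, s). f p s)"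
  shows "continuous_on A (\<lambda>p. integral {0..m p} (f p))"
proof -
  have "continuous_on A (\<lambda>p. m p * integral {0..1} (\<lambda>r. f p (m p * r)))"
  proof (intro continuous_on_mult m)
    have "continuous_on (A \<times> {0..1}) (\<lambda>x. (\<lambda>(p, s). f p s) (fst x, m (fst x) * snd x))"
    proof (rule continuous_on_compose2[OF f])
      show "continuous_on (A \<times> {0..1}) (\<lambda>x. (fst x, m (fst x) * snd x))"
        by (intro continuous_intros continuous_on_compose2[OF m(1)]) auto
    qed (use m(2) in \<open>auto intro: mult_left_le\<close>)
    then have "continuous_on (A \<times> cbox 0 1) (\<lambda>(p, r). f p (m p * r))"
      by (simp add: case_prod_unfold)
    from integral_continuous_on_param[OF this]
    show "continuous_on A (\<lambda>p. integral {0..1} (\<lambda>r. f p (m p * r)))" by simp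
  qed
  moreover have "integral {0..m p} (f p) = m p * integral {0..1} (\<lambda>r. f p (m p * r))" if "p \<in> A" for p
  proof (rule integral_rescale)
    have "continuous_on {0..m p} (\<lambda>s. (\<lambda>(p, s). f p s) (p, s))"
      by (rule continuous_on_compose2[OF f]) (use that in \<open>auto intro!: continuous_intros\<close>)
    then show "continuous_on {0..m p} (f p)" by simp
  qed (use that m in auto)
  ultimately show ?thesis by (simp cong: continuous_on_cong)
qed

lemma integral_close_to_constant:
  fixes f :: "real \<Rightarrow> real"
  assumes "f integrable_on {a..b}" "a \<le> b" "\<And>x. x \<in> {a..b} \<Longrightarrow> \<bar>f x - c\<bar> \<le> e"
  shows "\<bar>integral {a..b} f - (b - a) * c\<bar> \<le> (b - a) * e"
proof -
  have "((\<lambda>x. f x - c) has_integral (integral {a..b} f - (b - a) * c)) {a..b}"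
    using assms has_integral_const_real[of c a b]
    by (intro has_integral_diff) (auto simp: integrable_integral)
  moreover have "0 \<le> e" using assms(3)[of a] assms(2) by auto
  ultimately have "norm (integral {a..b} f - (b - a) * c) \<le> e * Henstock_Kurzweil_Integration.content {a..b}"
    using assms by (intro has_integral_bound_real[where f="\<lambda>x. f x - c"]) auto
  then show ?thesis using assms(2) by (simp add: mult.commute)
qed

text \<open>The smooth functions \<open>sqrt (f\<^sup>2 + \<delta>\<^sup>2)\<close> have the same value at both endpoints, and their
  derivatives converge boundedly to \<open>sgn f * f'\<close> as \<open>\<delta> \<rightarrow> 0\<close>.\<close>

lemma has_integral_sgn_derivative:
  fixes f f' :: "real \<Rightarrow> real"
  assumes "a \<le> b" and f: "\<And>x. x \<in> {a..b} \<Longrightarrow> (f has_real_derivative f' x) (at x within {a..b})"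
    and f': "continuous_on {a..b} f'" and fab: "f a = f b"
  shows "((\<lambda>x. sgn (f x) * f' x) has_integral 0) {a..b}"
proof -
  define d where "d n = inverse (real (Suc n))" for n
  have d: "d n > 0" for n by (simp add: d_def)
  define g where "g n x = f x * f' x / sqrt ((f x)\<^sup>2 + (d n)\<^sup>2)" for n x
  have pos: "(f x)\<^sup>2 + (d n)\<^sup>2 > 0" for n x
    using d[of n] by (intro add_nonneg_pos) auto
  have "(g n has_integral (sqrt ((f b)\<^sup>2 + (d n)\<^sup>2) - sqrt ((f a)\<^sup>2 + (d n)\<^sup>2))) {a..b}" for n
  proof (rule has_real_integral_derivative[OF \<open>a \<le> b\<close>])
    fix x assume "x \<in> {a..b}"
    note f[OF this, derivative_intros]
    show "((\<lambda>x. sqrt ((f x)\<^sup>2 + (d n)\<^sup>2)) has_real_derivative g n x) (at x within {a..b})"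
      using pos[of x n] by (auto intro!: derivative_eq_intros simp: g_def field_simps)
  qed
  then have g: "(g n has_integral 0) {a..b}" for n using fab by simp
  show ?thesis
  proof (rule has_integral_dominated_convergence)
    show "(g n has_integral 0) {a..b}" for n by (rule g)
    show "(\<lambda>x. \<bar>f' x\<bar>) integrable_on {a..b}"
      using f' by (intro integrable_continuous_real continuous_intros)
    show "\<forall>x\<in>{a..b}. norm (g n x) \<le> \<bar>f' x\<bar>" for n
    proof
      fix x
      have "\<bar>f x\<bar> \<le> sqrt ((f x)\<^sup>2 + (d n)\<^sup>2)" by (intro real_le_rsqrt) simp
      then have "\<bar>f x\<bar> * \<bar>f' x\<bar> \<le> sqrt ((f x)\<^sup>2 + (d n)\<^sup>2) * \<bar>f' x\<bar>" by (intro mult_right_mono) auto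
      then show "norm (g n x) \<le> \<bar>f' x\<bar>"
        using pos[of x n] by (simp add: g_def abs_mult field_simps)
    qed
    show "\<forall>x\<in>{a..b}. (\<lambda>n. g n x) \<longlonglongrightarrow> sgn (f x) * f' x"
    proof
      fix x
      have d0: "d \<longlonglongrightarrow> 0" unfolding d_def by (rule LIMSEQ_inverse_real_of_nat)
      show "(\<lambda>n. g n x) \<longlonglongrightarrow> sgn (f x) * f' x"
      proof (cases "f x = 0")
        case False
        then have "(\<lambda>n. g n x) \<longlonglongrightarrow> f x * f' x / sqrt ((f x)\<^sup>2 + 0\<^sup>2)"
          unfolding g_def by (intro tendsto_intros d0) auto
        moreover have "f x * f' x / sqrt ((f x)\<^sup>2 + 0\<^sup>2) = sgn (f x) * f' x"
          using False by (simp add: sgn_if)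
        ultimately show ?thesis by simp
      qed (simp add: g_def)
    qed
  qed simp
qed

lemma has_real_derivative_if_increments:
  fixes f :: "real \<Rightarrow> real"
  assumes "\<And>e. 0 < e \<Longrightarrow> \<exists>d>0. \<forall>a\<in>S. \<forall>b\<in>S. a < b \<longrightarrow> b - a < d \<longrightarrow> (a = t \<or> b = t) \<longrightarrow>
      \<bar>f b - f a - (b - a) * c\<bar> \<le> (b - a) * e" and "t \<in> S"
  shows "(f has_real_derivative c) (at t within S)"
  unfolding has_field_derivative_def has_derivative_within_alt
proof (intro conjI allI impI)
  show "bounded_linear ((*) c)" by (rule bounded_linear_mult_right)
  fix e :: real assume "0 < e"
  from assms(1)[OF this] obtain d where d: "d > 0"
    "\<And>a b. a \<in> S \<Longrightarrow> b \<in> S \<Longrightarrow> a < b \<Longrightarrow> b - a < d \<Longrightarrow> a = t \<or> b = t \<Longrightarrow>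
      \<bar>f b - f a - (b - a) * c\<bar> \<le> (b - a) * e" by blast
  show "\<exists>d>0. \<forall>y\<in>S. norm (y - t) < d \<longrightarrow> norm (f y - f t - c * (y - t)) \<le> e * norm (y - t)"
  proof (intro exI[of _ d] conjI ballI impI)
    fix y assume y: "y \<in> S" "norm (y - t) < d"
    consider "y = t" | "y < t" | "t < y" by linarith
    then show "norm (f y - f t - c * (y - t)) \<le> e * norm (y - t)"
    proof cases
      case 2
      then have "\<bar>f t - f y - (t - y) * c\<bar> \<le> (t - y) * e" using d(2)[of y t] y assms(2) by auto
      then show ?thesis using 2 by (simp add: abs_le_iff algebra_simps)
    next
      case 3
      then have "\<bar>f y - f t - (y - t) * c\<bar> \<le> (y - t) * e" using d(2)[of t y] y assms(2) by auto
      then show ?thesis using 3 by (simp add: abs_le_iff algebra_simps)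
    qed simp
  qed (use d in auto)
qed

lemma uniformly_continuous_rectangle:
  fixes g :: "real \<Rightarrow> real \<Rightarrow> real"
  assumes "continuous_on ({0..T} \<times> {0..1}) (\<lambda>(t, x). g t x)" "e > 0"
  obtains d where "d > 0"
    "\<And>t s x y. t \<in> {0..T} \<Longrightarrow> s \<in> {0..T} \<Longrightarrow> x \<in> {0..1} \<Longrightarrow> y \<in> {0..1} \<Longrightarrow>
      \<bar>t - s\<bar> < d \<Longrightarrow> \<bar>x - y\<bar> < d \<Longrightarrow> \<bar>g t x - g s y\<bar> \<le> e"
proof -
  have "uniformly_continuous_on ({0..T} \<times> {0..1}) (\<lambda>(t, x). g t x)"
    by (intro compact_uniformly_continuous assms compact_Times) auto
  then obtain d where d: "d > 0" "\<And>p q. p \<in> {0..T} \<times> {0..1} \<Longrightarrow> q \<in> {0..T} \<times> {0..1} \<Longrightarrow> dist p q < d \<Longrightarrow>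
      dist (case p of (t, x) \<Rightarrow> g t x) (case q of (t, x) \<Rightarrow> g t x) < e"
    unfolding uniformly_continuous_on_def using \<open>e > 0\<close> by metis
  show ?thesis
  proof
    show "d / 2 > 0" using d by simp
    fix t s x y assume a: "t \<in> {0..T}" "s \<in> {0..T}" "x \<in> {0..1}" "y \<in> {0..1}" "\<bar>t - s\<bar> < d / 2" "\<bar>x - y\<bar> < d / 2"
    have "dist (t, x) (s, y) \<le> \<bar>t - s\<bar> + \<bar>x - y\<bar>"
      unfolding dist_prod_def dist_real_def using sqrt_sum_squares_le_sum_abs by simp
    also have "\<dots> < d" using a by simp
    finally show "\<bar>g t x - g s y\<bar> \<le> e" using d(2)[of "(t, x)" "(s, y)"] a by (auto simp: dist_real_def)
  qed
qed

lemma continuous_on_rectangleD: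
  assumes "continuous_on (A \<times> B) (\<lambda>(t, x). g t x)" "continuous_on S a" "continuous_on S b"
    "\<And>s. s \<in> S \<Longrightarrow> a s \<in> A" "\<And>s. s \<in> S \<Longrightarrow> b s \<in> B"
  shows "continuous_on S (\<lambda>s. g (a s) (b s))"
proof -
  have "continuous_on S (\<lambda>s. (\<lambda>(t, x). g t x) (a s, b s))"
    by (rule continuous_on_compose2[OF assms(1)]) (use assms in \<open>auto intro!: continuous_intros\<close>)
  then show ?thesis by simp
qed


section \<open>Transport on a circle with a nonlocal Lipschitz reaction\<close>

text \<open>The equation \<open>u\<^sub>t + u\<^sub>x = G (u t) x\<close> on \<open>[0,\<infinity>) \<times> [0,1]\<close>, where the jump \<open>u t 1 - u t 0\<close> is
  constant in time, is solved at once for all times. Following a characteristic back to the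
  initial line or to the left edge, and there replacing \<open>u (t - x) 0\<close> by \<open>u (t - x) 1\<close> minus
  the jump, turns it into a fixed point equation.  The right hand side evaluates \<open>u\<close> at the same
  point of the circle, which is no contraction in the sup norm; in the norm with weight
  \<open>exp (2 * x - l * t)\<close> the passage from the right to the left edge gains a factor of
  \<open>exp (-2)\<close>, and for large \<open>l\<close> the reaction contributes little.\<close>

theorem transport_on_circle_exists:
  fixes u0 :: "real \<Rightarrow> real" and G :: "(real \<Rightarrow> real) \<Rightarrow> real \<Rightarrow> real"
  assumes u0: "continuous_on {0..1} u0" and "0 \<le> L"
    and lip: "\<And>p q d x. continuous_on {0..1} p \<Longrightarrow> continuous_on {0..1} q \<Longrightarrow>
        (\<And>y. y \<in> {0..1} \<Longrightarrow> \<bar>p y - q y\<bar> \<le> d) \<Longrightarrow> x \<in> {0..1} \<Longrightarrow> \<bar>G p x - G q x\<bar> \<le> L * d"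
    and bnd: "\<And>p x. continuous_on {0..1} p \<Longrightarrow> x \<in> {0..1} \<Longrightarrow> \<bar>G p x\<bar> \<le> B"
    and cont: "\<And>u :: real \<Rightarrow> real \<Rightarrow> real. continuous_on ({0..} \<times> {0..1}) (\<lambda>(t, x). u t x) \<Longrightarrow>
        continuous_on ({0..} \<times> {0..1}) (\<lambda>(t, x). G (u t) x)"
  obtains u where "continuous_on ({0..} \<times> {0..1}) (\<lambda>(t, x). u t x)"
    "\<And>x. x \<in> {0..1} \<Longrightarrow> u 0 x = u0 x"
    "\<And>t. 0 \<le> t \<Longrightarrow> u t 1 - u t 0 = u0 1 - u0 0"
    "\<And>t x h. 0 \<le> h \<Longrightarrow> h \<le> t \<Longrightarrow> h \<le> x \<Longrightarrow> x \<le> 1 \<Longrightarrow>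
      u t x - u (t - h) (x - h) = integral {0..h} (\<lambda>s. G (u (t - s)) (x - s))"
proof -
  define cl :: "real \<Rightarrow> real" where "cl x = max 0 (min 1 x)" for x
  define tp :: "real \<Rightarrow> real" where "tp t = max 0 t" for t
  have cl: "cl x \<in> {0..1}" "0 \<le> cl x" "cl x \<le> 1" for x by (auto simp: cl_def)
  have tp: "0 \<le> tp t" "tp t \<in> {0..}" for t by (auto simp: tp_def)
  have cl_cont: "continuous_on A (\<lambda>z. cl (f z))" if "continuous_on A f" for A :: "(real \<times> real) set" and f
    unfolding cl_def using that by (intro continuous_intros)
  have tp_cont: "continuous_on A (\<lambda>z. tp (f z))" if "continuous_on A f" for A :: "(real \<times> real) set" and f
    unfolding tp_def using that by (intro continuous_intros)
  define l where "l = 2 + 4 * L * exp 2"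
  have l: "l \<ge> 2" "l > 0" "L * exp 2 / l \<le> 1/4"
    using \<open>0 \<le> L\<close> by (auto simp: l_def field_simps add_pos_nonneg)
  \<comment> \<open>\<open>U f\<close> is the function with weighted form \<open>f\<close>; \<open>R u\<close> is the right hand side of the fixed
    point equation.\<close>
  define U :: "((real \<times> real) \<Rightarrow>\<^sub>C real) \<Rightarrow> real \<Rightarrow> real \<Rightarrow> real"
    where "U f t x = exp (l * tp t - 2 * cl x) * apply_bcontfun f (tp t, cl x)" for f t x
  define R :: "(real \<Rightarrow> real \<Rightarrow> real) \<Rightarrow> real \<Rightarrow> real \<Rightarrow> real"
    where "R u t x = u0 (max 0 (x - t)) + u (max 0 (t - x)) 1 - u 0 1
      + integral {0..min t x} (\<lambda>s. G (u (t - s)) (x - s))" for u t x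
  define V where "V f z = exp (2 * cl (snd z) - l * tp (fst z)) * R (U f) (tp (fst z)) (cl (snd z))" for f z
  have U_cont: "continuous_on UNIV (\<lambda>(t, x). U f t x)" for f
    unfolding U_def case_prod_unfold
    by (intro continuous_intros tp_cont cl_cont continuous_on_compose2[OF continuous_on_apply_bcontfun[of UNIV f]]) auto
  have U_slice: "continuous_on A (U f t)" for f t A
    using continuous_on_rectangleD[where g="U f" and S=A and a="\<lambda>_. t" and b="\<lambda>x. x" and A=UNIV and B=UNIV] U_cont[of f]
    by (auto intro: continuous_intros)
  have GU_cont: "continuous_on ({0..} \<times> {0..1}) (\<lambda>(t, x). G (U f t) x)" for f
    by (rule cont) (rule continuous_on_subset[OF U_cont subset_UNIV])
  have char_int: "(\<lambda>s. G (U f (t - s)) (x - s)) integrable_on {0..m}"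
    if "m \<le> t" "m \<le> x" "x \<le> 1" for f t x m
    by (intro integrable_continuous_real continuous_on_rectangleD[OF GU_cont])
      (use that in \<open>auto intro!: continuous_intros\<close>)
  have R_cont: "continuous_on ({0..} \<times> {0..1}) (\<lambda>z. R (U f) (fst z) (snd z))" for f
  proof -
    have "continuous_on ({0..} \<times> {0..1}) (\<lambda>z. integral {0..min (fst z) (snd z)} (\<lambda>s. G (U f (fst z - s)) (snd z - s)))"
    proof (rule continuous_on_integral_upper_limit)
      show "continuous_on {(p, s). p \<in> {0..} \<times> {0..1} \<and> 0 \<le> s \<and> s \<le> min (fst p) (snd p)}
          (\<lambda>(p, s). G (U f (fst p - s)) (snd p - s))"
        unfolding case_prod_unfold
        by (rule continuous_on_rectangleD[OF GU_cont]) (auto intro!: continuous_intros)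
    qed (auto intro!: continuous_intros)
    then show ?thesis
      unfolding R_def
      by (intro continuous_intros continuous_on_compose2[OF u0]
          continuous_on_rectangleD[OF continuous_on_subset[OF U_cont subset_UNIV]]) auto
  qed
  have V_cont: "continuous_on UNIV (V f)" for f
  proof -
    have "continuous_on UNIV (\<lambda>z. R (U f) (fst (tp (fst z), cl (snd z))) (snd (tp (fst z), cl (snd z))))"
      by (rule continuous_on_compose2[OF R_cont])
        (use tp cl in \<open>auto intro!: continuous_intros tp_cont cl_cont\<close>)
    then show ?thesis
      unfolding V_def by (intro continuous_intros tp_cont cl_cont) simp
  qed
  have edge: "\<bar>exp (2 * x - l * t) * (U f (max 0 (t - x)) 1 - U f 0 1
        - (U g (max 0 (t - x)) 1 - U g 0 1))\<bar> \<le> D / 2"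
    if "x \<in> {0..1}" "0 \<le> t" "\<And>z. \<bar>apply_bcontfun f z - apply_bcontfun g z\<bar> \<le> D" for f g t x D
  proof (cases "t \<le> x")
    case True
    have "0 \<le> D" using that(3)[of undefined] by linarith
    then show ?thesis using True by simp
  next
    case False
    note fg = that(3)
    have D: "0 \<le> D" using that(3)[of undefined] by linarith
    have "(4::real) \<le> exp 2"
    proof -
      have "(2::real) * 2 \<le> exp 1 * exp 1" using exp_ge_add_one_self[of 1] by (intro mult_mono) auto
      also have "\<dots> = exp 2" by (simp flip: exp_add)
      finally show ?thesis by simp
    qed
    then have e2: "exp (-2 :: real) \<le> 1/4" by (simp add: exp_minus field_simps)
    have df: "\<bar>U f s 1 - U g s 1\<bar> \<le> exp (l * s - 2) * D" if "0 \<le> s" for s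
    proof -
      have "\<bar>U f s 1 - U g s 1\<bar> = exp (l * s - 2) * \<bar>apply_bcontfun f (s, 1) - apply_bcontfun g (s, 1)\<bar>"
        using that by (simp add: U_def tp_def cl_def abs_mult flip: right_diff_distrib)
      also have "\<dots> \<le> exp (l * s - 2) * D" using fg by (intro mult_left_mono) auto
      finally show ?thesis .
    qed
    have "\<bar>U f (t - x) 1 - U f 0 1 - (U g (t - x) 1 - U g 0 1)\<bar>
        \<le> \<bar>U f (t - x) 1 - U g (t - x) 1\<bar> + \<bar>U f 0 1 - U g 0 1\<bar>" by linarith
    also have "\<dots> \<le> exp (l * (t - x) - 2) * D + exp (l * 0 - 2) * D"
      using df[of "t - x"] df[of 0] False by (intro add_mono) auto
    finally have "exp (2 * x - l * t) * \<bar>U f (t - x) 1 - U f 0 1 - (U g (t - x) 1 - U g 0 1)\<bar>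
        \<le> exp (2 * x - l * t) * (exp (l * (t - x) - 2) * D + exp (l * 0 - 2) * D)"
      by (rule mult_left_mono) simp
    also have "\<dots> = (exp (2 * x - l * x - 2) + exp (2 * x - l * t - 2)) * D"
      by (simp add: algebra_simps flip: exp_add)
    also have "\<dots> \<le> (exp (- 2) + exp (- 2)) * D"
    proof -
      have "2 * x \<le> l * x" using l that(1) by (intro mult_right_mono) auto
      moreover have "l * x \<le> l * t" using l False by (intro mult_left_mono) auto
      ultimately show ?thesis using D by (intro mult_right_mono add_mono) auto
    qed
    also have "\<dots> \<le> (1/4 + 1/4) * D" using e2 D by (intro mult_right_mono) auto
    finally show ?thesis using False by (simp add: abs_mult)
  qed
  have V_bounded: "\<exists>b. \<forall>z. \<bar>V f z\<bar> \<le> b" for f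
  proof -
    have "bounded (u0 ` {0..1})" by (intro compact_imp_bounded compact_continuous_image u0 compact_Icc)
    then obtain b0 where b0: "\<And>x. x \<in> {0..1} \<Longrightarrow> \<bar>u0 x\<bar> \<le> b0" unfolding bounded_iff real_norm_def by blast
    show ?thesis
    proof (intro exI allI)
      fix z :: "real \<times> real"
      define t x where "t = tp (fst z)" and "x = cl (snd z)"
      have tx: "0 \<le> t" "x \<in> {0..1}" "0 \<le> x" "x \<le> 1" using tp cl by (auto simp: t_def x_def)
      have B: "0 \<le> B" using bnd[of "\<lambda>_. 0" 0] by (auto intro: continuous_intros)
      have "\<bar>integral {0..min t x} (\<lambda>s. G (U f (t - s)) (x - s))\<bar> \<le> B * (min t x - 0)"
        unfolding real_norm_def[symmetric]
        by (rule integral_bound) (use tx in \<open>auto intro!: bnd U_slice continuous_on_rectangleD[OF GU_cont] continuous_intros\<close>)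
      also have "\<dots> \<le> B * 1" using B tx by (intro mult_left_mono) auto
      finally have i: "\<bar>integral {0..min t x} (\<lambda>s. G (U f (t - s)) (x - s))\<bar> \<le> B" by simp
      have "0 \<le> l * t" using tx l by (intro mult_nonneg_nonneg) auto
      then have w: "exp (2 * x - l * t) \<le> exp 2" using tx by simp
      have e: "\<bar>exp (2 * x - l * t) * (U f (max 0 (t - x)) 1 - U f 0 1)\<bar> \<le> norm f / 2"
        using edge[OF tx(2,1), of f 0 "norm f"] norm_bounded[of f] by (simp add: U_def)
      have "\<bar>V f z\<bar> = \<bar>exp (2 * x - l * t) * (u0 (max 0 (x - t)) + integral {0..min t x} (\<lambda>s. G (U f (t - s)) (x - s)))
         + exp (2 * x - l * t) * (U f (max 0 (t - x)) 1 - U f 0 1)\<bar>"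
        by (simp add: V_def R_def t_def x_def algebra_simps)
      also have "\<dots> \<le> \<bar>exp (2 * x - l * t) * (u0 (max 0 (x - t)) + integral {0..min t x} (\<lambda>s. G (U f (t - s)) (x - s)))\<bar>
         + norm f / 2" using e by linarith
      also have "\<dots> \<le> exp 2 * (b0 + B) + norm f / 2"
        unfolding abs_mult using w i b0[of "max 0 (x - t)"] tx
        by (intro add_mono mult_mono order_refl) auto
      finally show "\<bar>V f z\<bar> \<le> exp 2 * (b0 + B) + norm f / 2" .
    qed
  qed
  have "V f \<in> bcontfun" for f
    using V_bounded[of f] V_cont[of f] unfolding real_norm_def[symmetric] by (metis bcontfun_normI)
  then have ap: "apply_bcontfun (Bcontfun (V f)) = V f" for f by (simp add: Bcontfun_inverse)
  have contraction: "dist (Bcontfun (V f)) (Bcontfun (V g)) \<le> 3/4 * dist f g" for f g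
  proof (rule dist_bound)
    fix z :: "real \<times> real"
    define t x where "t = tp (fst z)" and "x = cl (snd z)"
    have tx: "0 \<le> t" "x \<in> {0..1}" "0 \<le> x" "x \<le> 1" using tp cl by (auto simp: t_def x_def)
    define D where "D = dist f g"
    have fg: "\<bar>apply_bcontfun f z - apply_bcontfun g z\<bar> \<le> D" for z
      using dist_bounded[of f z g] by (simp add: D_def dist_real_def)
    have "0 \<le> D" by (simp add: D_def)
    have e: "\<bar>exp (2 * x - l * t) * (U f (max 0 (t - x)) 1 - U f 0 1 - (U g (max 0 (t - x)) 1 - U g 0 1))\<bar> \<le> D / 2"
      by (rule edge[OF tx(2,1) fg])
    define I where "I h = integral {0..min t x} (\<lambda>s. G (U h (t - s)) (x - s))" for h
    have Gd: "\<bar>G (U f s) y - G (U g s) y\<bar> \<le> L * (exp (l * s) * D)" if "0 \<le> s" "y \<in> {0..1}" for s y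
    proof (rule lip[OF U_slice U_slice _ that(2)])
      fix y assume "y \<in> {0..1::real}"
      have "\<bar>U f s y - U g s y\<bar> = exp (l * s - 2 * y) * \<bar>apply_bcontfun f (s, y) - apply_bcontfun g (s, y)\<bar>"
        using that(1) \<open>y \<in> {0..1}\<close> by (simp add: U_def tp_def cl_def abs_mult flip: right_diff_distrib)
      also have "\<dots> \<le> exp (l * s) * D" using fg \<open>y \<in> {0..1}\<close> by (intro mult_mono) auto
      finally show "\<bar>U f s y - U g s y\<bar> \<le> exp (l * s) * D" .
    qed
    have E: "((\<lambda>s. L * (exp (l * (t - s)) * D)) has_integral
        (- L * D * exp (l * (t - min t x)) / l - (- L * D * exp (l * (t - 0)) / l))) {0..min t x}"
      by (rule has_real_integral_derivative) (use tx l in \<open>auto intro!: derivative_eq_intros\<close>)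
    have "\<bar>I f - I g\<bar> = norm (integral {0..min t x} (\<lambda>s. G (U f (t - s)) (x - s) - G (U g (t - s)) (x - s)))"
      unfolding I_def using tx by (subst integral_diff) (auto intro: char_int)
    also have "\<dots> \<le> integral {0..min t x} (\<lambda>s. L * (exp (l * (t - s)) * D))"
      using E tx by (intro integral_norm_bound_integral integrable_diff char_int) (auto intro!: Gd simp: has_integral_integrable)
    also have "\<dots> \<le> L * D * exp (l * t) / l"
      unfolding integral_unique[OF E] using \<open>0 \<le> L\<close> \<open>0 \<le> D\<close> l(2) by simp
    finally have "exp (2 * x - l * t) * \<bar>I f - I g\<bar> \<le> exp (2 * x - l * t) * (L * D * exp (l * t) / l)"
      by (rule mult_left_mono) simp
    also have "\<dots> = L * exp (2 * x) / l * D" by (simp flip: exp_add add: exp_diff)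
    also have "\<dots> \<le> L * exp 2 / l * D"
      using tx \<open>0 \<le> L\<close> \<open>0 \<le> D\<close> l by (intro mult_right_mono divide_right_mono mult_left_mono) auto
    also have "\<dots> \<le> 1/4 * D" using l(3) \<open>0 \<le> D\<close> by (rule mult_right_mono)
    finally have i: "\<bar>exp (2 * x - l * t) * (I f - I g)\<bar> \<le> 1/4 * D" by (simp add: abs_mult)
    have "V f z - V g z = exp (2 * x - l * t) * (U f (max 0 (t - x)) 1 - U f 0 1 - (U g (max 0 (t - x)) 1 - U g 0 1))
        + exp (2 * x - l * t) * (I f - I g)"
      by (simp add: V_def R_def I_def t_def x_def algebra_simps)
    then show "dist (apply_bcontfun (Bcontfun (V f)) z) (apply_bcontfun (Bcontfun (V g)) z) \<le> 3/4 * dist f g"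
      using e i unfolding ap dist_real_def D_def by linarith
  qed
  obtain f where f: "Bcontfun (V f) = f"
    using banach_fix_type[of "3/4" "\<lambda>f. Bcontfun (V f)"] contraction by auto
  then have "apply_bcontfun f = V f" using ap[of f] by simp
  then have fixp: "U f t x = R (U f) t x" if "0 \<le> t" "x \<in> {0..1}" for t x
  proof -
    have "tp t = t" "cl x = x" using that by (auto simp: tp_def cl_def)
    then show ?thesis
      unfolding U_def[of f t x] \<open>apply_bcontfun f = V f\<close> V_def by (simp flip: exp_add mult.assoc)
  qed
  show thesis
  proof
    show "continuous_on ({0..} \<times> {0..1}) (\<lambda>(t, x). U f t x)"
      by (rule continuous_on_subset[OF U_cont subset_UNIV])
    show init: "U f 0 x = u0 x" if "x \<in> {0..1}" for x
      using fixp[of 0 x] that by (simp add: R_def)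
    show "U f t 1 - U f t 0 = u0 1 - u0 0" if "0 \<le> t" for t
      using fixp[of t 0] that init[of 1] by (simp add: R_def max_def)
    fix t x h :: real assume h: "0 \<le> h" "h \<le> t" "h \<le> x" "x \<le> 1"
    define g where "g s = G (U f (t - s)) (x - s)" for s
    have g: "g integrable_on {0..min t x}" unfolding g_def using h by (intro char_int) auto
    have "integral {0..min (t - h) (x - h)} (\<lambda>s. G (U f (t - h - s)) (x - h - s))
        = integral {0..min t x - h} (\<lambda>s. g (s + h))"
      by (simp add: g_def algebra_simps min_diff_distrib_left)
    also have "\<dots> = integral {h..min t x} g"
    proof -
      have "(g has_integral integral {h..min t x} g) (cbox h (min t x))"
        using integrable_subinterval_real[OF g, of h "min t x"] h by (auto simp: integrable_integral)
      from has_integral_affinity[OF this, of 1 h] show ?thesis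
        by (auto intro!: integral_unique simp: algebra_simps image_affinity_atLeastAtMost)
    qed
    finally have "U f t x - U f (t - h) (x - h) = integral {0..min t x} g - integral {h..min t x} g"
      using fixp[of t x] fixp[of "t - h" "x - h"] h unfolding R_def g_def by simp
    also have "\<dots> = integral {0..h} g"
      using Henstock_Kurzweil_Integration.integral_combine[OF _ _ g, of h] h by auto
    finally show "U f t x - U f (t - h) (x - h) = integral {0..h} (\<lambda>s. G (U f (t - s)) (x - s))"
      unfolding g_def .
  qed
qed


section \<open>The transport equation of the profile slope\<close>

definition profile :: "(real \<Rightarrow> real \<Rightarrow> real) \<Rightarrow> real \<Rightarrow> real \<Rightarrow> real"
  where "profile u t x = integral {0..x} (u t)"

text \<open>Differentiating the equation for \<open>Q\<close> in \<open>\<eta>\<close> gives \<open>u\<^sub>t + u\<^sub>x = K' Q * u\<close> for the slope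
  \<open>u = Q\<^sub>\<eta>\<close>, but \<open>Q\<close> is merely \<open>C\<^sup>1\<close>; hence the equation is integrated along characteristics.
  The boundary condition and the equation for \<open>N\<close> become the constant jump \<open>c\<close> of \<open>u\<close> across the
  ends of \<open>[0,1]\<close>. Only short pieces of characteristics are used, and \<open>h < 1\<close> avoids the
  degenerate piece that starts at one corner and ends at another.\<close>

definition slope_solution :: "(real \<Rightarrow> real) \<Rightarrow> real \<Rightarrow> real \<Rightarrow> (real \<Rightarrow> real \<Rightarrow> real) \<Rightarrow> bool"
  where "slope_solution K c T u \<longleftrightarrow>
    continuous_on ({0..T} \<times> {0..1}) (\<lambda>(t, x). u t x) \<and>
    (\<forall>t\<in>{0..T}. u t 1 - u t 0 = c) \<and>
    (\<forall>t x h. 0 \<le> h \<longrightarrow> h \<le> t \<longrightarrow> t \<le> T \<longrightarrow> h \<le> x \<longrightarrow> x \<le> 1 \<longrightarrow> h < 1 \<longrightarrow>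
      u t x - u (t - h) (x - h) =
        integral {0..h} (\<lambda>s. deriv K (profile u (t - s) (x - s)) * u (t - s) (x - s)))"

lemma profile_0 [simp]: "profile u t 0 = 0"
  by (simp add: profile_def)

lemma slice_continuous:
  assumes "continuous_on (A \<times> {0..1}) (\<lambda>(t, x). u t x)" "t \<in> A" "S \<subseteq> {0..1}"
  shows "continuous_on S (u t)"
  by (rule continuous_on_rectangleD[OF assms(1)]) (use assms in \<open>auto intro!: continuous_intros\<close>)

lemma profile_continuous:
  assumes "continuous_on (A \<times> {0..1}) (\<lambda>(t, x). u t x)"
  shows "continuous_on (A \<times> {0..1}) (\<lambda>(t, x). profile u t x)"
proof -
  have "continuous_on (A \<times> {0..1}) (\<lambda>z. integral {0..snd z} (u (fst z)))"
  proof (rule continuous_on_integral_upper_limit)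
    show "continuous_on {(p, s). p \<in> A \<times> {0..1} \<and> 0 \<le> s \<and> s \<le> snd p} (\<lambda>(p, s). u (fst p) s)"
      unfolding case_prod_unfold
      by (rule continuous_on_rectangleD[OF assms]) (auto intro!: continuous_intros)
  qed (auto intro!: continuous_intros)
  then show ?thesis by (simp add: profile_def case_prod_unfold)
qed

lemma profile_has_derivative:
  assumes "continuous_on {0..1} (u t)" "x \<in> {0..1}"
  shows "(profile u t has_real_derivative u t x) (at x within {0..1})"
  unfolding profile_def using integral_has_real_derivative[OF assms] .

lemma has_real_derivative_compose_within:
  assumes "(f has_real_derivative D) (at x within S)" "(g has_real_derivative E) (at (f x))"
  shows "((\<lambda>x. g (f x)) has_real_derivative E * D) (at x within S)"
  using DERIV_image_chain[of g E f x S D] assms DERIV_subset[OF assms(2)] by (auto simp: comp_def)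

text \<open>Since \<open>f\<close> grows at most linearly away from its zero \<open>c\<close>, the function \<open>exp (- 2 * L * t) * (q - c)\<^sup>2\<close>
  does not increase.\<close>

lemma equilibrium_invariant:
  fixes q f :: "real \<Rightarrow> real"
  assumes T: "0 \<le> T" and q: "\<And>t. t \<in> {0..T} \<Longrightarrow> (q has_real_derivative f (q t)) (at t within {0..T})"
    and f: "\<And>y. \<bar>f y\<bar> \<le> L * \<bar>y - c\<bar>" and "q 0 = c"
  shows "q T = c"
proof -
  define G where "G t = exp (- 2 * L * t) * (q t - c)\<^sup>2" for t
  have dG: "(G has_real_derivative exp (- 2 * L * t) * (2 * (q t - c) * f (q t) - 2 * L * (q t - c)\<^sup>2)) (at t within {0..T})"
    if "t \<in> {0..T}" for t
    unfolding G_def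
    by (rule derivative_eq_intros q that refl | simp add: algebra_simps)+
  have "G T \<le> G 0"
  proof (rule DERIV_nonpos_imp_decreasing_open[OF T])
    show "continuous_on {0..T} G"
      using dG by (meson DERIV_continuous continuous_on_eq_continuous_within)
    fix t assume t: "0 < t" "t < T"
    have "(q t - c) * f (q t) \<le> \<bar>q t - c\<bar> * \<bar>f (q t)\<bar>" by (simp flip: abs_mult)
    also have "\<dots> \<le> \<bar>q t - c\<bar> * (L * \<bar>q t - c\<bar>)" using f by (intro mult_left_mono) auto
    also have "\<dots> = L * (q t - c)\<^sup>2" by (simp add: power2_eq_square)
    finally have "exp (- 2 * L * t) * (2 * ((q t - c) * f (q t) - L * (q t - c)\<^sup>2)) \<le> 0"
      by (intro mult_nonneg_nonpos) auto
    then have "exp (- 2 * L * t) * (2 * (q t - c) * f (q t) - 2 * L * (q t - c)\<^sup>2) \<le> 0"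
      by (simp add: algebra_simps)
    moreover have "(G has_real_derivative exp (- 2 * L * t) * (2 * (q t - c) * f (q t) - 2 * L * (q t - c)\<^sup>2)) (at t)"
      using dG[of t] t at_within_Icc_at[of 0 t T] by auto
    ultimately show "\<exists>y. (G has_real_derivative y) (at t) \<and> y \<le> 0" by blast
  qed
  then have "(q T - c)\<^sup>2 \<le> 0" using \<open>q 0 = c\<close> by (simp add: G_def mult_le_0_iff)
  then show ?thesis by simp
qed

text \<open>A minimum principle for transport on a circle: \<open>w\<close> takes its minimum over \<open>[0,T] \<times> [0,1]\<close>,
  after a strictly increasing function of time is added, on the initial line. At another minimum
  point, moved to the right edge if it is on the left one, \<open>w t x \<le> w t 0\<close>, so by assumption
  \<open>w\<close> does not increase to first order along the characteristic followed backwards from there,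
  and the added function strictly decreases.\<close>

lemma circle_minimum_principle:
  fixes w :: "real \<Rightarrow> real \<Rightarrow> real"
  assumes cont: "continuous_on ({0..T} \<times> {0..1}) (\<lambda>(t, x). w t x)"
    and circle: "\<And>t. t \<in> {0..T} \<Longrightarrow> w t 0 = w t 1"
    and backward: "\<And>t x. 0 < t \<Longrightarrow> t \<le> T \<Longrightarrow> 0 < x \<Longrightarrow> x \<le> 1 \<Longrightarrow> w t x \<le> w t 0 \<Longrightarrow>
      \<exists>r D. 0 < r \<and> r \<le> min t x \<and> D \<le> 0 \<and> ((\<lambda>h. w (t - h) (x - h)) has_real_derivative D) (at 0 within {0..r})"
    and init: "\<And>x. x \<in> {0..1} \<Longrightarrow> m \<le> w 0 x"
    and tx: "t \<in> {0..T}" "x \<in> {0..1}"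
  shows "m \<le> w t x"
proof (rule field_le_epsilon)
  fix e' :: real assume "0 < e'"
  define e where "e = e' / (T + 1)"
  have e: "0 < e" using \<open>0 < e'\<close> tx by (simp add: e_def)
  define z where "z t x = w t x + e * t" for t x
  have "continuous_on ({0..T} \<times> {0..1}) (\<lambda>p. z (fst p) (snd p))"
    unfolding z_def using cont by (intro continuous_intros) (simp add: case_prod_unfold)
  then obtain p where p: "p \<in> {0..T} \<times> {0..1}" "\<And>q. q \<in> {0..T} \<times> {0..1} \<Longrightarrow> z (fst p) (snd p) \<le> z (fst q) (snd q)"
    using continuous_attains_inf[of "{0..T} \<times> {0..1}" "\<lambda>p. z (fst p) (snd p)"] tx
    by (auto simp: compact_Times)
  define s y where "s = fst p" and "y = (if snd p = 0 then 1 else snd p)"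
  have sy: "0 \<le> s" "s \<le> T" "0 < y" "y \<le> 1" using p(1) by (auto simp: s_def y_def)
  have zp: "z (fst p) (snd p) = z s y" using circle[of s] sy by (auto simp: s_def y_def z_def)
  have min: "z s y \<le> z a b" if "a \<in> {0..T}" "b \<in> {0..1}" for a b
    using p(2)[of "(a, b)"] that zp by simp
  have "s = 0"
  proof (rule ccontr)
    assume "s \<noteq> 0"
    with sy have "0 < s" by simp
    have "w s y \<le> w s 0" using min[of s 0] sy by (simp add: z_def)
    from backward[OF \<open>0 < s\<close> sy(2-4) this] obtain r D where r: "0 < r" "r \<le> min s y" "D \<le> 0"
      "((\<lambda>h. w (s - h) (y - h)) has_real_derivative D) (at 0 within {0..r})" by blast
    have "((\<lambda>h. z (s - h) (y - h)) has_real_derivative D - e) (at 0 within {0..r})"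
      unfolding z_def by (rule derivative_eq_intros r refl | simp)+
    moreover have "D - e < 0" using r e by simp
    ultimately obtain d where d: "d > 0" "\<And>h. 0 < h \<Longrightarrow> 0 + h \<in> {0..r} \<Longrightarrow> h < d \<Longrightarrow>
        z (s - 0) (y - 0) > z (s - (0 + h)) (y - (0 + h))"
      using has_real_derivative_neg_dec_right by blast
    define h where "h = min r (d / 2)"
    have h: "0 < h" "h \<le> r" "h < d" using d r by (auto simp: h_def)
    then have "z (s - h) (y - h) < z s y" using d(2)[of h] by simp
    moreover have "z s y \<le> z (s - h) (y - h)" using h r sy by (intro min) auto
    ultimately show False by simp
  qed
  then have "m \<le> z s y" using init[of y] sy by (simp add: z_def)
  also have "\<dots> \<le> z t x" by (rule min[OF tx])
  also have "\<dots> \<le> w t x + e'"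
  proof -
    have "e * t \<le> e * (T + 1)" using e tx by (intro mult_left_mono) auto
    then show ?thesis using tx by (simp add: z_def e_def)
  qed
  finally show "m \<le> w t x + e'" .
qed

text \<open>The excess \<open>u - K Q\<close> equals \<open>1 / N\<close> at both ends of \<open>[0,1]\<close>. Along characteristics the
  terms \<open>K' Q * K Q\<close> cancel, and the excess relaxes towards its value at the ends.\<close>

definition excess :: "(real \<Rightarrow> real) \<Rightarrow> (real \<Rightarrow> real \<Rightarrow> real) \<Rightarrow> real \<Rightarrow> real \<Rightarrow> real"
  where "excess K u t x = u t x - K (profile u t x)"

context
  fixes K :: "real \<Rightarrow> real"
  assumes K: "\<And>x. (K has_real_derivative deriv K x) (at x)"
    and K': "continuous_on UNIV (deriv K)"
begin

lemma K_continuous: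
  "continuous_on S f \<Longrightarrow> continuous_on S (\<lambda>x. K (f x))"
  "continuous_on S f \<Longrightarrow> continuous_on S (\<lambda>x. deriv K (f x))"
  for f :: "'a::topological_space \<Rightarrow> real"
proof -
  have "continuous_on UNIV K" using K by (intro DERIV_continuous_on) (auto intro: has_field_derivative_at_within)
  then show "continuous_on S f \<Longrightarrow> continuous_on S (\<lambda>x. K (f x))"
    by (rule continuous_on_compose2) auto
  show "continuous_on S f \<Longrightarrow> continuous_on S (\<lambda>x. deriv K (f x))"
    by (rule continuous_on_compose2[OF K']) auto
qed

lemma reaction_continuous:
  assumes "continuous_on (A \<times> {0..1}) (\<lambda>(t, x). u t x)"
  shows "continuous_on (A \<times> {0..1}) (\<lambda>(t, x). deriv K (profile u t x) * u t x)"
  using assms profile_continuous[OF assms] unfolding case_prod_unfold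
  by (intro continuous_intros K_continuous)

lemma reaction_integral:
  assumes "continuous_on {0..1} (u t)" "x \<in> {0..1}"
  shows "((\<lambda>y. deriv K (profile u t y) * u t y) has_integral (K (profile u t x) - K 0)) {0..x}"
proof -
  have "((\<lambda>y. deriv K (profile u t y) * u t y) has_integral (K (profile u t x) - K (profile u t 0))) {0..x}"
  proof (rule has_real_integral_derivative)
    fix y assume y: "y \<in> {0..x}"
    have "(profile u t has_real_derivative u t y) (at y within {0..1})"
      using assms y by (intro profile_has_derivative) auto
    then have "(profile u t has_real_derivative u t y) (at y within {0..x})"
      by (rule DERIV_subset) (use assms in auto)
    from has_real_derivative_compose_within[OF this K]
    show "((\<lambda>y. K (profile u t y)) has_real_derivative deriv K (profile u t y) * u t y) (at y within {0..x})" .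
  qed (use assms in auto)
  then show ?thesis by simp
qed

text \<open>Along a characteristic \<open>Q = profile u\<close> satisfies \<open>dQ/dt = u t 0 - K 0 + K Q\<close>. This is the
  mass balance on \<open>[0,x]\<close>: inflow through the left edge contributes \<open>u t 0\<close>, and the reaction
  integrates to \<open>K Q - K 0\<close>.\<close>

lemma profile_increment:
  assumes u: "slope_solution K c T u" and e: "0 < e"
  obtains d where "0 < d" "\<And>t x h. 0 < h \<Longrightarrow> h < d \<Longrightarrow> h \<le> t \<Longrightarrow> t \<le> T \<Longrightarrow> h \<le> x \<Longrightarrow> x \<le> 1 \<Longrightarrow>
     \<bar>profile u t x - profile u (t - h) (x - h) - h * (u t 0 - K 0 + K (profile u t x))\<bar> \<le> h * e"
proof -
  define g where "g t x = deriv K (profile u t x) * u t x" for t x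
  have uc: "continuous_on ({0..T} \<times> {0..1}) (\<lambda>(t, x). u t x)" using u by (simp add: slope_solution_def)
  have gc: "continuous_on ({0..T} \<times> {0..1}) (\<lambda>(t, x). g t x)" unfolding g_def by (rule reaction_continuous[OF uc])
  have e3: "0 < e / 3" using e by simp
  obtain d1 where d1: "0 < d1" "\<And>t s x y. t \<in> {0..T} \<Longrightarrow> s \<in> {0..T} \<Longrightarrow> x \<in> {0..1} \<Longrightarrow> y \<in> {0..1} \<Longrightarrow>
      \<bar>t - s\<bar> < d1 \<Longrightarrow> \<bar>x - y\<bar> < d1 \<Longrightarrow> \<bar>u t x - u s y\<bar> \<le> e / 3"
    using uniformly_continuous_rectangle[OF uc e3] by blast
  obtain d2 where d2: "0 < d2" "\<And>t s x y. t \<in> {0..T} \<Longrightarrow> s \<in> {0..T} \<Longrightarrow> x \<in> {0..1} \<Longrightarrow> y \<in> {0..1} \<Longrightarrow>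
      \<bar>t - s\<bar> < d2 \<Longrightarrow> \<bar>x - y\<bar> < d2 \<Longrightarrow> \<bar>g t x - g s y\<bar> \<le> e / 3"
    using uniformly_continuous_rectangle[OF gc e3] by blast
  have "bounded ((\<lambda>(t, x). g t x) ` ({0..T} \<times> {0..1}))"
    by (intro compact_imp_bounded compact_continuous_image gc compact_Times) auto
  then obtain C where C: "0 < C" "\<And>t x. t \<in> {0..T} \<Longrightarrow> x \<in> {0..1} \<Longrightarrow> \<bar>g t x\<bar> \<le> C"
    unfolding bounded_pos real_norm_def by auto
  show ?thesis
  proof
    show "0 < min (min d1 d2) (min (1/2) (e / (3 * C)))" using d1 d2 C e by simp
    fix t x h :: real
    assume h: "0 < h" "h < min (min d1 d2) (min (1/2) (e / (3 * C)))" "h \<le> t" "t \<le> T" "h \<le> x" "x \<le> 1"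
    have hC: "C * h \<le> e / 3" using h C by (simp add: field_simps)
    have ut: "continuous_on S (u t)" "continuous_on S (u (t - h))" "continuous_on S (g t)" if "S \<subseteq> {0..1}" for S
      using slice_continuous[OF uc _ that] slice_continuous[OF gc _ that] h by auto
    have i1: "\<bar>integral {0..h} (u t) - (h - 0) * u t 0\<bar> \<le> (h - 0) * (e / 3)"
      using h by (intro integral_close_to_constant integrable_continuous_real ut d1(2)) auto
    have i2: "\<bar>integral {0..h} (g t) - (h - 0) * 0\<bar> \<le> (h - 0) * C"
      using h C by (intro integral_close_to_constant integrable_continuous_real ut) auto
    have i2': "\<bar>h * integral {0..h} (g t)\<bar> \<le> h * (e / 3)"
    proof -
      have "\<bar>integral {0..h} (g t)\<bar> \<le> e / 3" using i2 hC by (simp add: mult.commute)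
      then show ?thesis using h by (simp add: abs_mult mult_left_mono)
    qed
    have step: "\<bar>u t y - u (t - h) (y - h) - h * g t y\<bar> \<le> h * (e / 3)" if y: "y \<in> {h..x}" for y
    proof -
      have "u t y - u (t - h) (y - h) = integral {0..h} (\<lambda>s. g (t - s) (y - s))"
        using u h y unfolding slope_solution_def g_def by auto
      moreover have "\<bar>integral {0..h} (\<lambda>s. g (t - s) (y - s)) - (h - 0) * g t y\<bar> \<le> (h - 0) * (e / 3)"
        using h y by (intro integral_close_to_constant integrable_continuous_real continuous_on_rectangleD[OF gc] d2(2))
          (auto intro!: continuous_intros)
      ultimately show ?thesis by simp
    qed
    have sh: "continuous_on {h..x} (\<lambda>y. u (t - h) (y - h))"
      by (rule continuous_on_rectangleD[OF uc]) (use h in \<open>auto intro!: continuous_intros\<close>)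
    have cD: "continuous_on {h..x} (\<lambda>y. u t y - u (t - h) (y - h) - h * g t y)"
      using h by (intro continuous_intros sh ut) auto
    have "\<bar>integral {h..x} (\<lambda>y. u t y - u (t - h) (y - h) - h * g t y) - (x - h) * 0\<bar> \<le> (x - h) * (h * (e / 3))"
      using h step by (intro integral_close_to_constant integrable_continuous_real cD) auto
    also have "\<dots> \<le> 1 * (h * (e / 3))" using h e by (intro mult_right_mono) auto
    finally have i3: "\<bar>integral {h..x} (\<lambda>y. u t y - u (t - h) (y - h) - h * g t y)\<bar> \<le> h * (e / 3)" by simp
    have "integral {h..x} (\<lambda>y. u t y - u (t - h) (y - h) - h * g t y)
        = integral {h..x} (u t) - integral {h..x} (\<lambda>y. u (t - h) (y - h)) - h * integral {h..x} (g t)"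
      using h by (simp add: integral_diff integrable_continuous_real ut sh continuous_intros)
    moreover have "integral {h..x} (\<lambda>y. u (t - h) (y - h)) = profile u (t - h) (x - h)"
    proof -
      show ?thesis
        using integral_shift_Icc_real[of h x "u (t - h)" "- h"] by (simp add: profile_def comp_def algebra_simps)
    qed
    moreover have "integral {0..h} (u t) + integral {h..x} (u t) = profile u t x"
      unfolding profile_def
      using h by (intro Henstock_Kurzweil_Integration.integral_combine integrable_continuous_real ut) auto
    moreover have "integral {0..h} (g t) + integral {h..x} (g t) = K (profile u t x) - K 0"
    proof -
      have "integral {0..h} (g t) + integral {h..x} (g t) = integral {0..x} (g t)"
        using h by (intro Henstock_Kurzweil_Integration.integral_combine integrable_continuous_real ut) auto
      moreover have "g t = (\<lambda>y. deriv K (profile u t y) * u t y)" by (simp add: g_def fun_eq_iff)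
      ultimately show ?thesis
        using reaction_integral[of u t x] ut(1)[of "{0..1}"] h by (simp add: integral_unique)
    qed
    then have "h * integral {0..h} (g t) + h * integral {h..x} (g t) = h * (K (profile u t x) - K 0)"
      by (metis distrib_left)
    ultimately show "\<bar>profile u t x - profile u (t - h) (x - h) - h * (u t 0 - K 0 + K (profile u t x))\<bar> \<le> h * e"
      using i1 i2' i3 unfolding abs_le_iff by (simp add: algebra_simps)
  qed
qed

lemma profile_time_derivative:
  assumes u: "slope_solution K c T u" and t: "t \<in> {0..T}" and x: "x \<in> {0..1}"
  shows "((\<lambda>t. profile u t x) has_real_derivative (u t 0 - K 0 + K (profile u t x) - u t x)) (at t within {0..T})"
proof (cases "x = 0")
  case True
  then show ?thesis by simp
next
  case False
  then have "0 < x" using x by simp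
  have uc: "continuous_on ({0..T} \<times> {0..1}) (\<lambda>(t, x). u t x)" using u by (simp add: slope_solution_def)
  note pc = profile_continuous[OF uc]
  have fc: "continuous_on ({0..T} \<times> {0..1}) (\<lambda>(t, y). u t 0 - K 0 + K (profile u t x))"
    unfolding case_prod_unfold
    by (intro continuous_intros K_continuous continuous_on_rectangleD[OF uc] continuous_on_rectangleD[OF pc]) (use x in auto)
  show ?thesis
  proof (rule has_real_derivative_if_increments[OF _ t])
    fix e :: real assume "0 < e"
    then have e3: "0 < e / 3" by simp
    obtain d1 where d1: "0 < d1" "\<And>t x h. 0 < h \<Longrightarrow> h < d1 \<Longrightarrow> h \<le> t \<Longrightarrow> t \<le> T \<Longrightarrow> h \<le> x \<Longrightarrow> x \<le> 1 \<Longrightarrow>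
        \<bar>profile u t x - profile u (t - h) (x - h) - h * (u t 0 - K 0 + K (profile u t x))\<bar> \<le> h * (e / 3)"
      using profile_increment[OF u e3] by blast
    obtain d2 where d2: "0 < d2" "\<And>t s x y. t \<in> {0..T} \<Longrightarrow> s \<in> {0..T} \<Longrightarrow> x \<in> {0..1} \<Longrightarrow> y \<in> {0..1} \<Longrightarrow>
        \<bar>t - s\<bar> < d2 \<Longrightarrow> \<bar>x - y\<bar> < d2 \<Longrightarrow> \<bar>u t x - u s y\<bar> \<le> e / 3"
      using uniformly_continuous_rectangle[OF uc e3] by blast
    obtain d3 where d3: "0 < d3" "\<And>t s a b. t \<in> {0..T} \<Longrightarrow> s \<in> {0..T} \<Longrightarrow> a \<in> {0..1} \<Longrightarrow> b \<in> {0..1} \<Longrightarrow>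
        \<bar>t - s\<bar> < d3 \<Longrightarrow> \<bar>a - b\<bar> < d3 \<Longrightarrow>
        \<bar>(u t 0 - K 0 + K (profile u t x)) - (u s 0 - K 0 + K (profile u s x))\<bar> \<le> e / 3"
      using uniformly_continuous_rectangle[OF fc e3] by blast
    show "\<exists>d>0. \<forall>a\<in>{0..T}. \<forall>b\<in>{0..T}. a < b \<longrightarrow> b - a < d \<longrightarrow> a = t \<or> b = t \<longrightarrow>
        \<bar>profile u b x - profile u a x - (b - a) * (u t 0 - K 0 + K (profile u t x) - u t x)\<bar> \<le> (b - a) * e"
    proof (intro exI[of _ "min (min d1 d2) (min d3 x)"] conjI ballI impI)
      show "0 < min (min d1 d2) (min d3 x)" using d1 d2 d3 \<open>0 < x\<close> by simp
      fix a b assume ab: "a \<in> {0..T}" "b \<in> {0..T}" "a < b" "b - a < min (min d1 d2) (min d3 x)" "a = t \<or> b = t"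
      define h where "h = b - a"
      have h: "0 < h" "h < d1" "h < d2" "h < d3" "h \<le> x" "h \<le> b" "b - h = a" using ab by (auto simp: h_def)
      have j1: "\<bar>profile u b x - profile u a (x - h) - h * (u b 0 - K 0 + K (profile u b x))\<bar> \<le> h * (e / 3)"
        using d1(2)[of h b x] h ab x by simp
      have "\<bar>(u b 0 - K 0 + K (profile u b x)) - (u t 0 - K 0 + K (profile u t x))\<bar> \<le> e / 3"
        using ab t x h d3(1) by (intro d3(2)[of b t 0 0]) auto
      then have "h * \<bar>(u b 0 - K 0 + K (profile u b x)) - (u t 0 - K 0 + K (profile u t x))\<bar> \<le> h * (e / 3)"
        using h by (intro mult_left_mono) auto
      then have j2: "\<bar>h * (u b 0 - K 0 + K (profile u b x)) - h * (u t 0 - K 0 + K (profile u t x))\<bar> \<le> h * (e / 3)"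
        using h by (simp add: abs_mult flip: right_diff_distrib)
      have ua: "u a integrable_on S" if "S = {l..r}" "0 \<le> l" "r \<le> 1" for S l r
        unfolding that(1) using ab that by (intro integrable_continuous_real slice_continuous[OF uc]) auto
      have "\<bar>integral {x - h..x} (u a) - (x - (x - h)) * u t x\<bar> \<le> (x - (x - h)) * (e / 3)"
        using ab t x h by (intro integral_close_to_constant ua d2(2)) auto
      moreover have "profile u a (x - h) + integral {x - h..x} (u a) = profile u a x"
        unfolding profile_def using h x
        by (intro Henstock_Kurzweil_Integration.integral_combine ua) auto
      ultimately have "\<bar>profile u b x - profile u a x - h * (u t 0 - K 0 + K (profile u t x) - u t x)\<bar> \<le> h * e"
        using j1 j2 unfolding abs_le_iff by (simp add: algebra_simps)
      then show "\<bar>profile u b x - profile u a x - (b - a) * (u t 0 - K 0 + K (profile u t x) - u t x)\<bar> \<le> (b - a) * e"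
        by (simp add: h_def)
    qed
  qed
qed

lemma profile_right_end:
  assumes u: "slope_solution K (K P - K 0) T u" and L: "\<And>x. \<bar>deriv K x\<bar> \<le> L"
    and "profile u 0 1 = P" and t: "t \<in> {0..T}"
  shows "profile u t 1 = P"
proof (rule equilibrium_invariant[of t "\<lambda>t. profile u t 1" "\<lambda>y. K y - K P" L P])
  fix s assume s: "s \<in> {0..t}"
  have "u s 1 - u s 0 = K P - K 0" using u s t by (auto simp: slope_solution_def)
  then show "((\<lambda>t. profile u t 1) has_real_derivative K (profile u s 1) - K P) (at s within {0..t})"
    using profile_time_derivative[OF u, of s 1] s t
    by (auto intro!: DERIV_subset[of "\<lambda>t. profile u t 1" _ s "{0..T}"] simp: algebra_simps)
next
  fix y
  have "norm (K y - K P) \<le> L * norm (y - P)"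
    by (rule field_differentiable_bound[of UNIV]) (use K L in auto)
  then show "\<bar>K y - K P\<bar> \<le> L * \<bar>y - P\<bar>" by simp
qed (use assms in auto)

lemma excess_back_derivative:
  assumes u: "slope_solution K c T u" and t: "0 < t" "t \<le> T" and x: "0 < x" "x \<le> 1"
  defines "r \<equiv> min (min t x) (1/2)"
  shows "((\<lambda>h. excess K u (t - h) (x - h)) has_real_derivative
      - (deriv K (profile u t x) * (excess K u t x - excess K u t 0))) (at 0 within {0..r})"
proof -
  define g where "g t x = deriv K (profile u t x) * u t x" for t x
  have r: "0 < r" "r \<le> t" "r \<le> x" "r < 1" using t x by (auto simp: r_def)
  have uc: "continuous_on ({0..T} \<times> {0..1}) (\<lambda>(t, x). u t x)" using u by (simp add: slope_solution_def)
  have gc: "continuous_on ({0..T} \<times> {0..1}) (\<lambda>(t, x). g t x)" unfolding g_def by (rule reaction_continuous[OF uc])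
  have gs: "continuous_on {0..r} (\<lambda>s. g (t - s) (x - s))"
    by (rule continuous_on_rectangleD[OF gc]) (use r t x in \<open>auto intro!: continuous_intros\<close>)
  have "((\<lambda>h. u t x - integral {0..h} (\<lambda>s. g (t - s) (x - s))) has_real_derivative 0 - g (t - 0) (x - 0)) (at 0 within {0..r})"
    using r by (intro DERIV_diff DERIV_const integral_has_real_derivative[OF gs]) auto
  moreover have "u t x - integral {0..h} (\<lambda>s. g (t - s) (x - s)) = u (t - h) (x - h)" if "h \<in> {0..r}" for h
  proof -
    have "u t x - u (t - h) (x - h) = integral {0..h} (\<lambda>s. g (t - s) (x - s))"
      using u that r t x unfolding slope_solution_def g_def by auto
    then show ?thesis by simp
  qed
  ultimately have du: "((\<lambda>h. u (t - h) (x - h)) has_real_derivative - g t x) (at 0 within {0..r})"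
    using r by (auto elim!: has_field_derivative_transform_within[where d=1])
  have dq: "((\<lambda>h. profile u (t - h) (x - h)) has_real_derivative - (u t 0 - K 0 + K (profile u t x))) (at 0 within {0..r})"
  proof (rule has_real_derivative_if_increments)
    fix e :: real assume "0 < e"
    obtain d where d: "0 < d" "\<And>t x h. 0 < h \<Longrightarrow> h < d \<Longrightarrow> h \<le> t \<Longrightarrow> t \<le> T \<Longrightarrow> h \<le> x \<Longrightarrow> x \<le> 1 \<Longrightarrow>
        \<bar>profile u t x - profile u (t - h) (x - h) - h * (u t 0 - K 0 + K (profile u t x))\<bar> \<le> h * e"
      using profile_increment[OF u \<open>0 < e\<close>] by blast
    have "\<bar>profile u (t - b) (x - b) - profile u (t - a) (x - a) - (b - a) * - (u t 0 - K 0 + K (profile u t x))\<bar> \<le> (b - a) * e"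
      if "a \<in> {0..r}" "b \<in> {0..r}" "a < b" "b - a < d" "a = 0 \<or> b = 0" for a b
    proof -
      have "a = 0" using that by auto
      then show ?thesis using d(2)[of b t x] that r t x by (simp add: abs_le_iff algebra_simps)
    qed
    then show "\<exists>d>0. \<forall>a\<in>{0..r}. \<forall>b\<in>{0..r}. a < b \<longrightarrow> b - a < d \<longrightarrow> (a = 0 \<or> b = 0) \<longrightarrow>
      \<bar>profile u (t - b) (x - b) - profile u (t - a) (x - a) - (b - a) * - (u t 0 - K 0 + K (profile u t x))\<bar> \<le> (b - a) * e"
      using d(1) by blast
  qed (use r in auto)
  have "((\<lambda>h. K (profile u (t - h) (x - h))) has_real_derivative
     deriv K (profile u (t - 0) (x - 0)) * - (u t 0 - K 0 + K (profile u t x))) (at 0 within {0..r})"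
    by (rule has_real_derivative_compose_within[OF dq K])
  from DERIV_diff[OF du this] show ?thesis
    by (simp add: excess_def g_def algebra_simps)
qed

text \<open>Both bounds come from the minimum principle, applied to the excess and to its negative.\<close>

lemma excess_bounds:
  assumes u: "slope_solution K (K P - K 0) T u"
    and ends: "\<And>t. t \<in> {0..T} \<Longrightarrow> profile u t 1 = P"
    and Q: "\<And>t x. t \<in> {0..T} \<Longrightarrow> x \<in> {0..1} \<Longrightarrow> deriv K (profile u t x) \<le> 0"
    and init: "\<And>x. x \<in> {0..1} \<Longrightarrow> m \<le> excess K u 0 x \<and> excess K u 0 x \<le> m'"
    and tx: "t \<in> {0..T}" "x \<in> {0..1}"
  shows "m \<le> excess K u t x \<and> excess K u t x \<le> m'"
proof -
  have uc: "continuous_on ({0..T} \<times> {0..1}) (\<lambda>(t, x). u t x)" using u by (simp add: slope_solution_def)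
  have ec: "continuous_on ({0..T} \<times> {0..1}) (\<lambda>(t, x). excess K u t x)"
    "continuous_on ({0..T} \<times> {0..1}) (\<lambda>(t, x). - excess K u t x)"
    using uc profile_continuous[OF uc] unfolding excess_def case_prod_unfold by (auto intro!: continuous_intros K_continuous)
  have circle: "excess K u t 0 = excess K u t 1" if "t \<in> {0..T}" for t
  proof -
    have "u t 1 - u t 0 = K P - K 0" using u that by (auto simp: slope_solution_def)
    then show ?thesis using ends[OF that] by (simp add: excess_def)
  qed
  have "m \<le> excess K u t x"
  proof (rule circle_minimum_principle[OF ec(1) circle _ _ tx])
    fix t x assume a: "0 < t" "t \<le> T" "0 < x" "x \<le> 1" "excess K u t x \<le> excess K u t 0"
    have "- (deriv K (profile u t x) * (excess K u t x - excess K u t 0)) \<le> 0"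
      using a Q[of t x] by (simp add: mult_nonpos_nonpos)
    then show "\<exists>r D. 0 < r \<and> r \<le> min t x \<and> D \<le> 0 \<and>
        ((\<lambda>h. excess K u (t - h) (x - h)) has_real_derivative D) (at 0 within {0..r})"
      using excess_back_derivative[OF u a(1-4)] a
      by (rule_tac x="min (min t x) (1/2)" in exI, rule_tac x="- (deriv K (profile u t x) * (excess K u t x - excess K u t 0))" in exI) auto
  qed (use init in auto)
  moreover have "- m' \<le> - excess K u t x"
  proof (rule circle_minimum_principle[OF ec(2) _ _ _ tx])
    fix t x assume a: "0 < t" "t \<le> T" "0 < x" "x \<le> 1" "- excess K u t x \<le> - excess K u t 0"
    have "- (- (deriv K (profile u t x) * (excess K u t x - excess K u t 0))) \<le> 0"
      using a Q[of t x] by (simp add: mult_nonpos_nonneg)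
    then show "\<exists>r D. 0 < r \<and> r \<le> min t x \<and> D \<le> 0 \<and>
        ((\<lambda>h. - excess K u (t - h) (x - h)) has_real_derivative D) (at 0 within {0..r})"
      using DERIV_minus[OF excess_back_derivative[OF u a(1-4)]] a
      by (rule_tac x="min (min t x) (1/2)" in exI, rule_tac x="- (- (deriv K (profile u t x) * (excess K u t x - excess K u t 0)))" in exI) auto
  qed (use init circle in auto)
  ultimately show ?thesis by simp
qed

end


section \<open>Global existence for the slope\<close>

lemma profile_between:
  assumes c: "continuous_on {0..1} (u t)" and u: "\<And>x. x \<in> {0..1} \<Longrightarrow> 0 \<le> u t x"
    and xy: "0 \<le> x" "x \<le> y" "y \<le> 1"
  shows "profile u t x \<le> profile u t y"
proof -
  have i: "u t integrable_on {a..b}" if "0 \<le> a" "b \<le> 1" for a b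
    using that by (intro integrable_continuous_real continuous_on_subset[OF c]) auto
  have "profile u t x + integral {x..y} (u t) = profile u t y"
    unfolding profile_def using xy by (intro Henstock_Kurzweil_Integration.integral_combine i) auto
  moreover have "0 \<le> integral {x..y} (u t)"
    using xy u by (intro Henstock_Kurzweil_Integration.integral_nonneg i) auto
  ultimately show ?thesis by simp
qed

lemma profile_in_range:
  assumes "continuous_on {0..1} (u t)" "\<And>x. x \<in> {0..1} \<Longrightarrow> 0 \<le> u t x" "x \<in> {0..1}"
  shows "profile u t x \<in> {0..profile u t 1}"
  using profile_between[of u t 0 x] profile_between[of u t x 1] assms by auto

text \<open>The reaction \<open>K' Q * u\<close> is not Lipschitz in \<open>u\<close>, so \<open>u\<close> is first clipped to \<open>[0,C]\<close> in it.
  As long as the clipped equation agrees with the original one, the bounds on the excess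
  \<open>u - K Q\<close> confine \<open>u\<close> to a smaller interval; hence there is no first time at which \<open>u\<close> leaves
  the interior of \<open>[0,C]\<close>.\<close>

theorem slope_solution_exists:
  fixes K u0 :: "real \<Rightarrow> real"
  assumes K: "\<And>x. (K has_real_derivative deriv K x) (at x)"
    and K': "\<And>x. (deriv K has_real_derivative deriv (deriv K) x) (at x)"
    and L1: "\<And>x. \<bar>deriv K x\<bar> \<le> L1" and L2: "\<And>x. \<bar>deriv (deriv K) x\<bar> \<le> L2"
    and Kpos: "\<And>y. y \<in> {0..P} \<Longrightarrow> 0 \<le> K y" and Kdec: "\<And>y. y \<in> {0..P} \<Longrightarrow> deriv K y \<le> 0"
    and u0: "continuous_on {0..1} u0" "u0 1 - u0 0 = K P - K 0" "integral {0..1} u0 = P"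
      "\<And>x. x \<in> {0..1} \<Longrightarrow> 0 \<le> u0 x" "\<And>x. x \<in> {0..1} \<Longrightarrow> K (integral {0..x} u0) < u0 x"
  obtains u m where "\<And>T. slope_solution K (K P - K 0) T u" "\<And>x. x \<in> {0..1} \<Longrightarrow> u 0 x = u0 x"
    "0 < m" "\<And>t x. 0 \<le> t \<Longrightarrow> x \<in> {0..1} \<Longrightarrow> m \<le> excess K u t x"
    "\<And>t x. 0 \<le> t \<Longrightarrow> x \<in> {0..1} \<Longrightarrow> 0 \<le> u t x" "\<And>t. 0 \<le> t \<Longrightarrow> profile u t 1 = P"
proof -
  have contK': "continuous_on UNIV (deriv K)"
    using K' by (intro DERIV_continuous_on) (auto intro: has_field_derivative_at_within)
  note [continuous_intros] = K_continuous[OF K contK']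
  have ex0_cont: "continuous_on {0..1} (\<lambda>x. u0 x - K (integral {0..x} u0))"
    by (intro continuous_intros u0 indefinite_integral_continuous_1 integrable_continuous_real)
  obtain x1 where x1: "x1 \<in> {0..1}" "\<And>x. x \<in> {0..1} \<Longrightarrow> u0 x1 - K (integral {0..x1} u0) \<le> u0 x - K (integral {0..x} u0)"
    using continuous_attains_inf[OF _ _ ex0_cont] by auto
  obtain x2 where x2: "\<And>x. x \<in> {0..1} \<Longrightarrow> u0 x - K (integral {0..x} u0) \<le> u0 x2 - K (integral {0..x2} u0)"
    using continuous_attains_sup[OF compact_Icc _ ex0_cont] by fastforce
  define m where "m = u0 x1 - K (integral {0..x1} u0)"
  define m' where "m' = u0 x2 - K (integral {0..x2} u0)"
  have m: "0 < m" using u0(5)[OF x1(1)] by (simp add: m_def)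
  have "m \<le> m'" using x2[OF x1(1)] by (simp add: m_def m'_def)
  have "bounded (K ` {0..P})"
    by (intro compact_imp_bounded compact_continuous_image continuous_intros compact_Icc)
  then obtain M where M: "0 < M" "\<And>y. y \<in> {0..P} \<Longrightarrow> \<bar>K y\<bar> \<le> M"
    unfolding bounded_pos real_norm_def by blast
  define C where "C = m' + M + 1"
  have C: "0 < C" using m \<open>m \<le> m'\<close> M by (simp add: C_def)
  define clip where "clip y = max 0 (min C y)" for y
  have clip: "\<bar>clip y\<bar> \<le> C" "\<bar>clip y - clip z\<bar> \<le> \<bar>y - z\<bar>" for y z
    using C by (auto simp: clip_def)
  have clip_cont: "continuous_on S clip" for S unfolding clip_def by (intro continuous_intros)
  define G :: "(real \<Rightarrow> real) \<Rightarrow> real \<Rightarrow> real" where "G p x = deriv K (integral {0..x} p) * clip (p x)" for p x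
  have "0 \<le> L1" "0 \<le> L2" using L1[of 0] L2[of 0] by auto
  obtain u where u: "continuous_on ({0..} \<times> {0..1}) (\<lambda>(t, x). u t x)"
    "\<And>x. x \<in> {0..1} \<Longrightarrow> u 0 x = u0 x"
    "\<And>t. 0 \<le> t \<Longrightarrow> u t 1 - u t 0 = u0 1 - u0 0"
    "\<And>t x h. 0 \<le> h \<Longrightarrow> h \<le> t \<Longrightarrow> h \<le> x \<Longrightarrow> x \<le> 1 \<Longrightarrow>
      u t x - u (t - h) (x - h) = integral {0..h} (\<lambda>s. G (u (t - s)) (x - s))"
  proof (rule transport_on_circle_exists[of u0 "L2 * C + L1" G "L1 * C"])
    show "0 \<le> L2 * C + L1" using \<open>0 \<le> L1\<close> \<open>0 \<le> L2\<close> C by simp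
    fix p q :: "real \<Rightarrow> real" and d x :: real
    assume x: "x \<in> {0..1}" and p: "continuous_on {0..1} p"
    then show "\<bar>G p x\<bar> \<le> L1 * C"
      unfolding G_def abs_mult using L1 clip \<open>0 \<le> L1\<close> by (intro mult_mono) auto
    assume q: "continuous_on {0..1} q" and d: "\<And>y. y \<in> {0..1} \<Longrightarrow> \<bar>p y - q y\<bar> \<le> d"
    have pq: "p integrable_on {0..x}" "q integrable_on {0..x}"
      using p q x by (auto intro!: integrable_continuous_real elim!: continuous_on_subset)
    have d0: "0 \<le> d" using d[of 0] by auto
    have "\<bar>integral {0..x} p - integral {0..x} q\<bar> = \<bar>integral {0..x} (\<lambda>y. p y - q y) - (x - 0) * 0\<bar>"
      using pq by (simp add: integral_diff)
    also have "\<dots> \<le> (x - 0) * d"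
      using x d pq by (intro integral_close_to_constant integrable_diff) auto
    also have "\<dots> \<le> 1 * d" using x d0 by (intro mult_right_mono) auto
    finally have i: "\<bar>integral {0..x} p - integral {0..x} q\<bar> \<le> d" by simp
    have "norm (deriv K (integral {0..x} p) - deriv K (integral {0..x} q)) \<le> L2 * norm (integral {0..x} p - integral {0..x} q)"
      by (rule field_differentiable_bound[of UNIV]) (use K' L2 in auto)
    also have "\<dots> \<le> L2 * d" using i \<open>0 \<le> L2\<close> by (intro mult_left_mono) auto
    finally have j: "\<bar>deriv K (integral {0..x} p) - deriv K (integral {0..x} q)\<bar> \<le> L2 * d" by simp
    have "G p x - G q x = (deriv K (integral {0..x} p) - deriv K (integral {0..x} q)) * clip (p x)
        + deriv K (integral {0..x} q) * (clip (p x) - clip (q x))"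
      by (simp add: G_def algebra_simps)
    then have "\<bar>G p x - G q x\<bar> \<le> \<bar>deriv K (integral {0..x} p) - deriv K (integral {0..x} q)\<bar> * \<bar>clip (p x)\<bar>
        + \<bar>deriv K (integral {0..x} q)\<bar> * \<bar>clip (p x) - clip (q x)\<bar>"
      by (metis abs_mult abs_triangle_ineq)
    also have "\<dots> \<le> L2 * d * C + L1 * d"
      using j L1 clip(1) order_trans[OF clip(2) d[OF x]] \<open>0 \<le> L1\<close> \<open>0 \<le> L2\<close> d0
      by (intro add_mono mult_mono) auto
    finally show "\<bar>G p x - G q x\<bar> \<le> (L2 * C + L1) * d" by (simp add: algebra_simps)
  next
    fix v :: "real \<Rightarrow> real \<Rightarrow> real"
    assume v: "continuous_on ({0..} \<times> {0..1}) (\<lambda>(t, x). v t x)"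
    show "continuous_on ({0..} \<times> {0..1}) (\<lambda>(t, x). G (v t) x)"
      using v profile_continuous[OF v] unfolding G_def case_prod_unfold profile_def
      by (intro continuous_intros continuous_on_compose2[OF clip_cont[of UNIV]]) auto
  qed (use u0 in auto)
  have uT: "continuous_on ({0..T} \<times> {0..1}) (\<lambda>(t, x). u t x)" for T
    by (rule continuous_on_subset[OF u(1)]) auto
  have us: "continuous_on {0..1} (u t)" if "0 \<le> t" for t
    by (rule slice_continuous[OF u(1)]) (use that in auto)
  have start: "profile u 0 x = integral {0..x} u0" if "x \<in> {0..1}" for x
    unfolding profile_def using u(2) that by (intro integral_cong) auto
  have solves: "slope_solution K (K P - K 0) T u"
    if b: "\<And>t x. t \<in> {0..T} \<Longrightarrow> x \<in> {0..1} \<Longrightarrow> 0 \<le> u t x \<and> u t x \<le> C" for T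
    unfolding slope_solution_def
  proof (intro conjI ballI allI impI)
    show "u t 1 - u t 0 = K P - K 0" if "t \<in> {0..T}" for t using u(3)[of t] u0(2) that by auto
    fix t x h :: real assume h: "0 \<le> h" "h \<le> t" "t \<le> T" "h \<le> x" "x \<le> 1" "h < 1"
    have "clip (u (t - s) (x - s)) = u (t - s) (x - s)" if "s \<in> {0..h}" for s
      using b[of "t - s" "x - s"] h that by (auto simp: clip_def)
    then show "u t x - u (t - h) (x - h) = integral {0..h} (\<lambda>s. deriv K (profile u (t - s) (x - s)) * u (t - s) (x - s))"
      unfolding u(4)[OF h(1,2,4,5)] G_def profile_def by (intro integral_cong) simp
  qed (rule uT)
  have strict: "profile u t 1 = P \<and> m \<le> excess K u t x \<and> 0 < u t x \<and> u t x < C"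
    if b: "\<And>t x. t \<in> {0..T} \<Longrightarrow> x \<in> {0..1} \<Longrightarrow> 0 \<le> u t x \<and> u t x \<le> C" and tx: "t \<in> {0..T}" "x \<in> {0..1}" for T t x
  proof -
    note s = solves[of T, OF b]
    have e: "profile u t 1 = P" if "t \<in> {0..T}" for t
      by (rule profile_right_end[OF K contK' s L1 _ that]) (use start[of 1] u0 in auto)
    have r: "profile u t x \<in> {0..P}" if "t \<in> {0..T}" "x \<in> {0..1}" for t x
      using profile_in_range[of u t x] us[of t] b[of t] that e[of t] by auto
    have ex: "m \<le> excess K u t x \<and> excess K u t x \<le> m'"
    proof (rule excess_bounds[OF K contK' s e _ _ tx])
      fix x :: real assume x: "x \<in> {0..1}"
      show "m \<le> excess K u 0 x \<and> excess K u 0 x \<le> m'"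
        using x1(2)[OF x] x2[OF x] start[OF x] u(2)[OF x] by (simp add: excess_def m_def m'_def)
    qed (use Kdec r in auto)
    have "0 \<le> K (profile u t x)" "\<bar>K (profile u t x)\<bar> \<le> M" using Kpos M(2) r[OF tx] by auto
    then show ?thesis using ex m e[OF tx(1)] by (auto simp: excess_def C_def)
  qed
  have inside: "0 < u t x \<and> u t x < C" if "0 \<le> t" "x \<in> {0..1}" for t x
  proof (rule ccontr)
    assume bad: "\<not> (0 < u t x \<and> u t x < C)"
    define Z where "Z = {p \<in> {0..t} \<times> {0..1}. max (- u (fst p) (snd p)) (u (fst p) (snd p) - C) \<ge> 0}"
    have "closed Z"
      unfolding Z_def
      using uT[of t]
      by (intro continuous_on_closed_Collect_le closed_Times closed_atLeastAtMost continuous_on_max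
          continuous_on_minus continuous_on_diff continuous_on_const) (simp_all add: case_prod_unfold)
    then have "compact (Z \<inter> {0..t} \<times> {0..1})"
      by (intro closed_Int_compact compact_Times compact_Icc)
    moreover have "Z \<inter> {0..t} \<times> {0..1} = Z" by (auto simp: Z_def)
    ultimately have "compact Z" by simp
    moreover have "(t, x) \<in> Z" using bad that by (auto simp: Z_def)
    ultimately have "\<exists>p\<in>Z. \<forall>q\<in>Z. fst p \<le> fst q"
      by (intro continuous_attains_inf continuous_on_fst continuous_on_id) auto
    then obtain p where p: "p \<in> Z" "\<And>q. q \<in> Z \<Longrightarrow> fst p \<le> fst q" by blast
    define s y where "s = fst p" and "y = snd p"
    have sy: "0 \<le> s" "s \<le> t" "y \<in> {0..1}" "u s y \<le> 0 \<or> C \<le> u s y"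
      using p(1) by (auto simp: Z_def s_def y_def max_def split: if_splits)
    have before: "0 < u r z \<and> u r z < C" if "0 \<le> r" "r < s" "z \<in> {0..1}" for r z
    proof (rule ccontr)
      assume "\<not> (0 < u r z \<and> u r z < C)"
      then have "(r, z) \<in> Z" using that sy by (auto simp: Z_def)
      from p(2)[OF this] that show False by (simp add: s_def)
    qed
    have upto: "0 \<le> u r z \<and> u r z \<le> C" if "r \<in> {0..s}" "z \<in> {0..1}" for r z
    proof (cases "r < s")
      case True
      then show ?thesis using before[of r z] that by auto
    next
      case False
      then have "r = s" using that by auto
      show ?thesis
      proof (cases "s = 0")
        case True
        have "profile u 0 z \<in> {0..profile u 0 1}"
          using profile_in_range[of u 0 z] us[of 0] u(2) u0(4) that by auto
        then have "profile u 0 z \<in> {0..P}" using start[of 1] u0(3) by simp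
        then have "\<bar>K (profile u 0 z)\<bar> \<le> M" by (rule M)
        moreover have "u0 z - K (profile u 0 z) \<le> m'" using x2[OF that(2)] start[OF that(2)] by (simp add: m'_def)
        ultimately have "u0 z \<le> C" by (auto simp: C_def)
        then show ?thesis using True \<open>r = s\<close> u(2)[of z] u0(4)[of z] that by auto
      next
        case False
        have "continuous_on {0..s} (\<lambda>r. u r z)"
          by (rule continuous_on_rectangleD[OF u(1)]) (use that in \<open>auto intro!: continuous_intros\<close>)
        then have "((\<lambda>r. u r z) \<longlongrightarrow> u s z) (at s within {0..s})"
          using sy by (auto simp: continuous_on_def)
        then have lim: "((\<lambda>r. u r z) \<longlongrightarrow> u s z) (at_left s)"
          using sy False by (simp add: at_within_Icc_at_left)
        have ev: "\<forall>\<^sub>F r in at_left s. 0 \<le> u r z \<and> u r z \<le> C"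
          using before that(2) sy False unfolding eventually_at_left_field
          by (intro exI[of _ 0]) (auto intro: less_imp_le)
        have "0 \<le> u s z"
          by (rule tendsto_lowerbound[OF lim]) (use ev in \<open>auto elim: eventually_mono\<close>)
        moreover have "u s z \<le> C"
          by (rule tendsto_upperbound[OF lim]) (use ev in \<open>auto elim: eventually_mono\<close>)
        ultimately show ?thesis using \<open>r = s\<close> by simp
      qed
    qed
    then have "0 < u s y \<and> u s y < C" using strict[of s s y] sy by auto
    then show False using sy by auto
  qed
  show thesis
  proof
    have b: "0 \<le> u t x \<and> u t x \<le> C" if "t \<in> {0..T}" "x \<in> {0..1}" for t x T
      using inside[of t x] that by auto
    show "slope_solution K (K P - K 0) T u" for T using b by (rule solves)
    show "u 0 x = u0 x" if "x \<in> {0..1}" for x using u(2) that .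
    show "0 < m" by (rule m)
    have st: "profile u t 1 = P \<and> m \<le> excess K u t x \<and> 0 < u t x \<and> u t x < C"
      if "0 \<le> t" "x \<in> {0..1}" for t x
      by (rule strict[of t]) (use b that in auto)
    then show "m \<le> excess K u t x" "0 \<le> u t x" if "0 \<le> t" "x \<in> {0..1}" for t x
      using that by (auto intro: less_imp_le)
    show "profile u t 1 = P" if "0 \<le> t" for t using st[of t 0] that by simp
  qed
qed


section \<open>Contraction in the mean\<close>

text \<open>If \<open>E > 0\<close>, then \<open>q1 > q2\<close>, and the monotonicity of \<open>f\<close> determines the sign of \<open>D\<close> in
  the cases where \<open>sgn E\<close> and \<open>sgn (p1 - p2)\<close> differ. If \<open>E = 0\<close>, then
  \<open>q1 = q2\<close> or \<open>f\<close> vanishes between them.\<close>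

lemma weighted_difference_sign:
  fixes f :: "real \<Rightarrow> real"
  assumes f: "continuous_on {0..P} f" "\<And>y. y \<in> {0..P} \<Longrightarrow> 0 \<le> f y"
    and q: "q1 \<in> {0..P}" "q2 \<in> {0..P}" and p: "0 \<le> p1" "0 \<le> p2"
  defines "E \<equiv> integral {0..q1} f - integral {0..q2} f" and "D \<equiv> f q1 * p1 - f q2 * p2"
  shows "antimono_on {0..P} f \<Longrightarrow> sgn E * D \<le> sgn (p1 - p2) * D" (is "?anti \<Longrightarrow> ?A")
    and "mono_on {0..P} f \<Longrightarrow> - (sgn E * D) \<le> sgn (p1 - p2) * D" (is "?mono \<Longrightarrow> ?B")
proof -
  have main: "(?anti \<longrightarrow> sgn (integral {0..q1} f - integral {0..q2} f) * (f q1 * p1 - f q2 * p2) \<le> sgn (p1 - p2) * (f q1 * p1 - f q2 * p2))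
    \<and> (?mono \<longrightarrow> - (sgn (integral {0..q1} f - integral {0..q2} f) * (f q1 * p1 - f q2 * p2)) \<le> sgn (p1 - p2) * (f q1 * p1 - f q2 * p2))"
    if q: "q1 \<in> {0..P}" "q2 \<in> {0..P}" "q2 \<le> q1" and p: "0 \<le> p1" "0 \<le> p2" for q1 q2 p1 p2
  proof -
    define D where "D = f q1 * p1 - f q2 * p2"
    have fc: "continuous_on {a..b} f" if "0 \<le> a" "b \<le> P" for a b
      by (rule continuous_on_subset[OF f(1)]) (use that in auto)
    have "integral {0..q2} f + integral {q2..q1} f = integral {0..q1} f"
      using q by (intro Henstock_Kurzweil_Integration.integral_combine integrable_continuous_real fc) auto
    then have E: "integral {0..q1} f - integral {0..q2} f = integral {q2..q1} f" by simp
    have f0: "0 \<le> f q1" "0 \<le> f q2" using f(2) q by auto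
    have "0 \<le> integral {q2..q1} f"
      using f q by (intro Henstock_Kurzweil_Integration.integral_nonneg integrable_continuous_real fc) auto
    then consider "integral {q2..q1} f = 0" | "0 < integral {q2..q1} f" by linarith
    then show ?thesis
    proof cases
      case 1
      have "q1 = q2 \<or> (f q1 = 0 \<and> f q2 = 0)"
      proof (cases "q1 = q2")
        case False
        then have "q2 < q1" using q by simp
        have "continuous_on {q2..q1} f" using q by (intro fc) auto
        moreover have "0 \<le> f y" if "y \<in> {q2..q1}" for y using f(2)[of y] q that by auto
        ultimately have "\<forall>y\<in>{q2..q1}. f y = 0"
          using integral_eq_0_iff[of q2 q1 f] 1 \<open>q2 < q1\<close> by simp
        then show ?thesis using \<open>q2 < q1\<close> by simp
      qed simp
      then have "0 \<le> sgn (p1 - p2) * D"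
      proof
        assume "q1 = q2"
        then have "sgn (p1 - p2) * D = f q1 * \<bar>p1 - p2\<bar>" by (simp add: D_def abs_sgn algebra_simps)
        then show ?thesis using f0 by simp
      qed (simp add: D_def)
      then show ?thesis unfolding E 1 by (simp add: D_def)
    next
      case 2
      have "D \<le> sgn (p1 - p2) * D" if ?anti
      proof -
        have "f q1 \<le> f q2" using that q by (auto simp: monotone_on_def)
        then have "D \<le> 0" if "p1 \<le> p2" unfolding D_def using mult_mono[of "f q1" "f q2" p1 p2] that f0 p by simp
        then show ?thesis by (cases p1 p2 rule: linorder_cases) auto
      qed
      moreover have "- D \<le> sgn (p1 - p2) * D" if ?mono
      proof -
        have "f q2 \<le> f q1" using that q by (auto simp: monotone_on_def)
        then have "0 \<le> D" if "p2 \<le> p1" unfolding D_def using mult_mono[of "f q2" "f q1" p2 p1] that f0 p by simp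
        then show ?thesis by (cases p1 p2 rule: linorder_cases) auto
      qed
      ultimately show ?thesis unfolding E using 2 by (auto simp: D_def)
    qed
  qed
  \<comment> \<open>Exchanging the two points changes the sign of \<open>E\<close>, \<open>D\<close> and \<open>p1 - p2\<close>.\<close>
  have swap: "sgn (a - b :: real) * (c - d) = sgn (b - a) * (d - c)" for a b c d
    by (auto simp: sgn_if)
  have "(?anti \<longrightarrow> ?A) \<and> (?mono \<longrightarrow> ?B)"
  proof (cases "q2 \<le> q1")
    case True
    then show ?thesis unfolding E_def D_def using main[OF q True p] by simp
  next
    case False
    then show ?thesis unfolding E_def D_def
      using main[OF q(2,1) _ p(2,1)]
      by (simp add: swap[of "integral {0..q1} f"] swap[of p1 p2])
  qed
  then show "?anti \<Longrightarrow> ?A" "?mono \<Longrightarrow> ?B" by auto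
qed

text \<open>On \<open>[0,P]\<close> write \<open>K' = k - A - B\<close> with \<open>k = k_max\<close>, where \<open>A y = \<integral>\<^sub>y\<^sup>P (K'')\<^sub>+\<close> decreases and
  \<open>B y = \<integral>\<^sub>0\<^sup>y (K'')\<^sub>-\<close> increases. In the reaction term for the difference of two slopes, the part
  with \<open>A\<close> is the derivative of \<open>E = \<integral>A(Q1) - \<integral>A(Q2)\<close>, and by monotonicity the sign of the
  difference may be exchanged for \<open>sgn E\<close>; likewise for \<open>B\<close>, with \<open>- sgn E\<close>. Since \<open>E\<close> vanishes at both
  ends, \<open>sgn E * E'\<close> has integral \<open>0\<close>. So only the constant \<open>k\<close> remains.\<close>

lemma reaction_difference_bound:
  fixes K p1 p2 :: "real \<Rightarrow> real"
  assumes K': "\<And>x. (deriv K has_real_derivative deriv (deriv K) x) (at x)"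
    and K'': "continuous_on UNIV (deriv (deriv K))"
    and p: "continuous_on {0..1} p1" "continuous_on {0..1} p2"
      "\<And>x. x \<in> {0..1} \<Longrightarrow> 0 \<le> p1 x" "\<And>x. x \<in> {0..1} \<Longrightarrow> 0 \<le> p2 x"
      "integral {0..1} p1 = P" "integral {0..1} p2 = P"
  obtains H where "(H has_integral 0) {0..1}"
    "\<And>x. x \<in> {0..1} \<Longrightarrow> sgn (p1 x - p2 x) *
      (deriv K (integral {0..x} p1) * p1 x - deriv K (integral {0..x} p2) * p2 x)
      \<le> k_max K P * \<bar>p1 x - p2 x\<bar> + H x"
proof -
  define f where "f y = max (deriv (deriv K) y) 0" for y
  define f' where "f' y = max (- deriv (deriv K) y) 0" for y
  have f0: "0 \<le> f y" "0 \<le> f' y" "deriv (deriv K) y = f y - f' y" for y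
    by (auto simp: f_def f'_def)
  have K''S: "continuous_on S (deriv (deriv K))" for S
    by (rule continuous_on_subset[OF K'']) auto
  have fi: "f integrable_on {a..b}" "f' integrable_on {a..b}" for a b
    unfolding f_def f'_def by (intro integrable_continuous_real continuous_intros K''S)+
  define A where "A y = integral {y..P} f" for y
  define B where "B y = integral {0..y} f'" for y
  have Ac: "continuous_on {0..P} A" unfolding A_def
    by (rule indefinite_integral_continuous_1'[OF fi(1)])
  have Bc: "continuous_on {0..P} B" unfolding B_def
    by (rule indefinite_integral_continuous_1[OF fi(2)])
  have A0: "0 \<le> A y" and B0: "0 \<le> B y" for y
    unfolding A_def B_def using f0 by (auto intro!: Henstock_Kurzweil_Integration.integral_nonneg fi)
  have anti: "antimono_on {0..P} A"
    unfolding A_def using f0 by (auto intro!: monotone_onI integral_subset_le fi)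
  have mono: "mono_on {0..P} B"
    unfolding B_def using f0 by (auto intro!: monotone_onI integral_subset_le fi)
  have split: "deriv K y = k_max K P - A y - B y" if "y \<in> {0..P}" for y
  proof -
    have "((deriv (deriv K)) has_integral (deriv K y - deriv K 0)) {0..y}"
      using that by (intro has_real_integral_derivative) (auto intro: has_field_derivative_at_within[OF K'])
    moreover have "deriv (deriv K) = (\<lambda>y. f y - f' y)" using f0(3) by blast
    ultimately have "deriv K y - deriv K 0 = integral {0..y} (\<lambda>y. f y - f' y)"
      by (metis integral_unique)
    also have "\<dots> = integral {0..y} f - B y" unfolding B_def by (intro integral_diff fi)
    also have "integral {0..y} f = integral {0..P} f - A y"
      using Henstock_Kurzweil_Integration.integral_combine[of 0 y P f] fi that by (simp add: A_def)
    finally show ?thesis using f_def[abs_def] by (simp add: k_max_def)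
  qed
  have prim: "\<exists>D. (\<forall>x\<in>{0..1}. D x = w (integral {0..x} p1) * p1 x - w (integral {0..x} p2) * p2 x) \<and>
      ((\<lambda>x. sgn (integral {0..integral {0..x} p1} w - integral {0..integral {0..x} p2} w) * D x) has_integral 0) {0..1}"
    if w: "continuous_on {0..P} w" for w
  proof -
    have r: "integral {0..x} p \<in> {0..P}"
      if "continuous_on {0..1} p" "\<And>x. x \<in> {0..1} \<Longrightarrow> 0 \<le> p x" "integral {0..1} p = P" "x \<in> {0..1}" for p :: "real \<Rightarrow> real" and x
      using profile_in_range[of "\<lambda>_. p" 0 x] that by (simp add: profile_def)
    have c: "continuous_on {0..1} (\<lambda>x. w (integral {0..x} p) * p x)"
      if p: "continuous_on {0..1} p" "\<And>x. x \<in> {0..1} \<Longrightarrow> 0 \<le> p x" "integral {0..1} p = P" for p :: "real \<Rightarrow> real"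
    proof -
      have "continuous_on {0..1} (\<lambda>x. w (integral {0..x} p))"
        by (rule continuous_on_compose2[OF w indefinite_integral_continuous_1[OF integrable_continuous_real[OF p(1)]]])
          (use r p in blast)
      then show ?thesis using p(1) by (rule continuous_on_mult)
    qed
    have d: "((\<lambda>x. integral {0..integral {0..x} p} w) has_real_derivative w (integral {0..x} p) * p x) (at x within {0..1})"
      if p: "continuous_on {0..1} p" "\<And>x. x \<in> {0..1} \<Longrightarrow> 0 \<le> p x" "integral {0..1} p = P" and x: "x \<in> {0..1}" for p :: "real \<Rightarrow> real" and x
    proof -
      have "((\<lambda>x. integral {0..x} p) has_real_derivative p x) (at x within {0..1})"
        by (rule integral_has_real_derivative[OF p(1) x])
      moreover have "((\<lambda>y. integral {0..y} w) has_real_derivative w (integral {0..x} p))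
          (at (integral {0..x} p) within (\<lambda>x. integral {0..x} p) ` {0..1})"
      proof (rule DERIV_subset[OF integral_has_real_derivative[OF w]])
        show "integral {0..x} p \<in> {0..P}" using r p x by blast
        show "(\<lambda>x. integral {0..x} p) ` {0..1} \<subseteq> {0..P}" using r p by blast
      qed
      ultimately have "((\<lambda>y. integral {0..y} w) \<circ> (\<lambda>x. integral {0..x} p) has_real_derivative w (integral {0..x} p) * p x)
          (at x within {0..1})"
        by (intro DERIV_image_chain)
      then show ?thesis by (simp add: comp_def)
    qed
    show ?thesis
    proof (intro exI conjI ballI)
      show "w (integral {0..x} p1) * p1 x - w (integral {0..x} p2) * p2 x = w (integral {0..x} p1) * p1 x - w (integral {0..x} p2) * p2 x" for x ..
      show "((\<lambda>x. sgn (integral {0..integral {0..x} p1} w - integral {0..integral {0..x} p2} w) *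
          (w (integral {0..x} p1) * p1 x - w (integral {0..x} p2) * p2 x)) has_integral 0) {0..1}"
      proof (rule has_integral_sgn_derivative[OF _ DERIV_diff[OF d[OF p(1,3,5)] d[OF p(2,4,6)]]
            continuous_on_diff[OF c[OF p(1,3,5)] c[OF p(2,4,6)]]])
      qed (use p in auto)
    qed
  qed
  obtain DA where DA: "\<And>x. x \<in> {0..1} \<Longrightarrow> DA x = A (integral {0..x} p1) * p1 x - A (integral {0..x} p2) * p2 x"
    "((\<lambda>x. sgn (integral {0..integral {0..x} p1} A - integral {0..integral {0..x} p2} A) * DA x) has_integral 0) {0..1}"
    using prim[OF Ac] by blast
  obtain DB where DB: "\<And>x. x \<in> {0..1} \<Longrightarrow> DB x = B (integral {0..x} p1) * p1 x - B (integral {0..x} p2) * p2 x"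
    "((\<lambda>x. sgn (integral {0..integral {0..x} p1} B - integral {0..integral {0..x} p2} B) * DB x) has_integral 0) {0..1}"
    using prim[OF Bc] by blast
  show ?thesis
  proof
    show "((\<lambda>x. sgn (integral {0..integral {0..x} p1} B - integral {0..integral {0..x} p2} B) * DB x
        - sgn (integral {0..integral {0..x} p1} A - integral {0..integral {0..x} p2} A) * DA x) has_integral 0) {0..1}"
      using has_integral_diff[OF DB(2) DA(2)] by simp
    fix x :: real assume x: "x \<in> {0..1}"
    have q: "integral {0..x} p1 \<in> {0..P}" "integral {0..x} p2 \<in> {0..P}"
      using profile_in_range[of "\<lambda>_. p1" 0 x] profile_in_range[of "\<lambda>_. p2" 0 x] p x by (auto simp: profile_def)
    have a: "sgn (integral {0..integral {0..x} p1} A - integral {0..integral {0..x} p2} A) * DA x \<le> sgn (p1 x - p2 x) * DA x"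
      unfolding DA(1)[OF x] by (rule weighted_difference_sign(1)[OF Ac A0 q p(3,4)[OF x] anti])
    have b: "- (sgn (integral {0..integral {0..x} p1} B - integral {0..integral {0..x} p2} B) * DB x) \<le> sgn (p1 x - p2 x) * DB x"
      unfolding DB(1)[OF x] by (rule weighted_difference_sign(2)[OF Bc B0 q p(3,4)[OF x] mono])
    have eq: "deriv K (integral {0..x} p1) * p1 x - deriv K (integral {0..x} p2) * p2 x
        = k_max K P * (p1 x - p2 x) - DA x - DB x"
      unfolding split[OF q(1)] split[OF q(2)] DA(1)[OF x] DB(1)[OF x] by (simp add: algebra_simps)
    have "sgn (p1 x - p2 x) * (deriv K (integral {0..x} p1) * p1 x - deriv K (integral {0..x} p2) * p2 x)
        = k_max K P * (sgn (p1 x - p2 x) * (p1 x - p2 x)) - sgn (p1 x - p2 x) * DA x - sgn (p1 x - p2 x) * DB x"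
      unfolding eq by (simp add: algebra_simps)
    also have "sgn (p1 x - p2 x) * (p1 x - p2 x) = \<bar>p1 x - p2 x\<bar>" by (simp add: abs_sgn mult.commute)
    finally show "sgn (p1 x - p2 x) * (deriv K (integral {0..x} p1) * p1 x - deriv K (integral {0..x} p2) * p2 x)
      \<le> k_max K P * \<bar>p1 x - p2 x\<bar> + (sgn (integral {0..integral {0..x} p1} B - integral {0..integral {0..x} p2} B) * DB x
        - sgn (integral {0..integral {0..x} p1} A - integral {0..integral {0..x} p2} A) * DA x)"
      using a b by linarith
  qed
qed

text \<open>The \<open>L\<^sup>1\<close> distance of two solutions is compared at times \<open>t - h\<close> and \<open>t\<close> along characteristics
  of length \<open>h\<close>, with the sign of the difference taken at the later time. The strip of width \<open>h\<close>
  at the left edge is fed by the strip at the right edge, because the jump is the same for both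
  solutions.\<close>

theorem slope_L1_contraction:
  fixes K :: "real \<Rightarrow> real"
  assumes K: "\<And>x. (K has_real_derivative deriv K x) (at x)"
    and K': "\<And>x. (deriv K has_real_derivative deriv (deriv K) x) (at x)"
    and K'': "continuous_on UNIV (deriv (deriv K))"
    and u1: "slope_solution K c T u1" "\<And>t x. t \<in> {0..T} \<Longrightarrow> x \<in> {0..1} \<Longrightarrow> 0 \<le> u1 t x"
      "\<And>t. t \<in> {0..T} \<Longrightarrow> profile u1 t 1 = P"
    and u2: "slope_solution K c T u2" "\<And>t x. t \<in> {0..T} \<Longrightarrow> x \<in> {0..1} \<Longrightarrow> 0 \<le> u2 t x"
      "\<And>t. t \<in> {0..T} \<Longrightarrow> profile u2 t 1 = P"
    and "0 \<le> T"
  shows "integral {0..1} (\<lambda>x. \<bar>u1 T x - u2 T x\<bar>) \<le>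
    exp (k_max K P * T) * integral {0..1} (\<lambda>x. \<bar>u1 0 x - u2 0 x\<bar>)"
proof -
  have contK': "continuous_on UNIV (deriv K)"
    using K' by (intro DERIV_continuous_on) (auto intro: has_field_derivative_at_within)
  have sgn_le: "sgn a * b \<le> \<bar>b\<bar>" for a b :: real by (auto simp: sgn_if)
  define k where "k = k_max K P"
  define v where "v t x = u1 t x - u2 t x" for t x
  define g where "g t x = deriv K (profile u1 t x) * u1 t x - deriv K (profile u2 t x) * u2 t x" for t x
  define F where "F t = integral {0..1} (\<lambda>x. \<bar>v t x\<bar>)" for t
  have c1: "continuous_on ({0..T} \<times> {0..1}) (\<lambda>(t, x). u1 t x)" and c2: "continuous_on ({0..T} \<times> {0..1}) (\<lambda>(t, x). u2 t x)"
    using u1 u2 by (auto simp: slope_solution_def)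
  have vc: "continuous_on ({0..T} \<times> {0..1}) (\<lambda>(t, x). v t x)"
    using c1 c2 unfolding v_def case_prod_unfold by (intro continuous_intros)
  have gc: "continuous_on ({0..T} \<times> {0..1}) (\<lambda>(t, x). g t x)"
    using reaction_continuous[OF K contK' c1] reaction_continuous[OF K contK' c2]
    unfolding g_def case_prod_unfold by (rule continuous_on_diff)
  have vs: "continuous_on S (v t)" if "t \<in> {0..T}" "S \<subseteq> {0..1}" for t S
    by (rule slice_continuous[OF vc that])
  have vi: "(\<lambda>x. \<bar>v t x\<bar>) integrable_on {a..b}" if "t \<in> {0..T}" "0 \<le> a" "b \<le> 1" for t a b
    using that by (intro integrable_continuous_real continuous_intros vs) auto
  have jump: "v t 1 = v t 0" if "t \<in> {0..T}" for t
  proof -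
    have "u1 t 1 - u1 t 0 = c" "u2 t 1 - u2 t 0 = c" using u1(1) u2(1) that by (auto simp: slope_solution_def)
    then show ?thesis by (simp add: v_def)
  qed
  have gi: "(\<lambda>s. g (t - s) (x - s)) integrable_on {0..h}"
    if "0 \<le> h" "h \<le> t" "t \<le> T" "h \<le> x" "x \<le> 1" for t x h
    by (intro integrable_continuous_real continuous_on_rectangleD[OF gc]) (use that in \<open>auto intro!: continuous_intros\<close>)
  have char: "v t x - v (t - h) (x - h) = integral {0..h} (\<lambda>s. g (t - s) (x - s))"
    if h: "0 \<le> h" "h \<le> t" "t \<le> T" "h \<le> x" "x \<le> 1" "h < 1" for t x h
  proof -
    have i: "(\<lambda>s. deriv K (profile u (t - s) (x - s)) * u (t - s) (x - s)) integrable_on {0..h}"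
      if "continuous_on ({0..T} \<times> {0..1}) (\<lambda>(t, x). u t x)" for u
      by (intro integrable_continuous_real continuous_on_rectangleD[OF reaction_continuous[OF K contK' that]])
        (use h in \<open>auto intro!: continuous_intros\<close>)
    have "v t x - v (t - h) (x - h) = (u1 t x - u1 (t - h) (x - h)) - (u2 t x - u2 (t - h) (x - h))"
      by (simp add: v_def)
    also have "\<dots> = integral {0..h} (\<lambda>s. deriv K (profile u1 (t - s) (x - s)) * u1 (t - s) (x - s)) -
        integral {0..h} (\<lambda>s. deriv K (profile u2 (t - s) (x - s)) * u2 (t - s) (x - s))"
      using u1(1) u2(1) h unfolding slope_solution_def by simp
    also have "\<dots> = integral {0..h} (\<lambda>s. g (t - s) (x - s))"
      unfolding g_def by (intro integral_diff[symmetric] i c1 c2)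
    finally show ?thesis .
  qed
  have "bounded ((\<lambda>(t, x). g t x) ` ({0..T} \<times> {0..1}))"
    by (intro compact_imp_bounded compact_continuous_image gc compact_Times) auto
  then obtain C where C: "0 < C" "\<And>t x. t \<in> {0..T} \<Longrightarrow> x \<in> {0..1} \<Longrightarrow> \<bar>g t x\<bar> \<le> C"
    unfolding bounded_pos real_norm_def by auto
  have charC: "\<bar>v t x - v (t - h) (x - h)\<bar> \<le> h * C" if h: "0 \<le> h" "h \<le> t" "t \<le> T" "h \<le> x" "x \<le> 1" "h < 1" for t x h
    using integral_close_to_constant[OF gi[OF h(1-5)] h(1), of 0 C] char[OF h] C h by simp
  have "F T \<le> exp (k * T) * F 0"
  proof (rule left_dini_exponential_bound[OF \<open>0 \<le> T\<close>])
    have "continuous_on ({0..T} \<times> cbox 0 1) (\<lambda>(t, x). \<bar>v t x\<bar>)"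
      using vc unfolding case_prod_unfold by (intro continuous_intros) auto
    from integral_continuous_on_param[OF this] show "continuous_on {0..T} F" by (simp add: F_def)
    fix t e :: real assume t: "0 < t" "t \<le> T" and e: "0 < e"
    then have e3: "0 < e / 3" and tT: "t \<in> {0..T}" by auto
    obtain H where H: "(H has_integral 0) {0..1}"
      "\<And>x. x \<in> {0..1} \<Longrightarrow> sgn (u1 t x - u2 t x) *
        (deriv K (integral {0..x} (u1 t)) * u1 t x - deriv K (integral {0..x} (u2 t)) * u2 t x)
        \<le> k_max K P * \<bar>u1 t x - u2 t x\<bar> + H x"
      by (rule reaction_difference_bound[OF K' K'', of "u1 t" "u2 t" P])
        (use u1(2,3)[of t] u2(2,3)[of t] tT slice_continuous[OF c1 tT] slice_continuous[OF c2 tT] in \<open>auto simp: profile_def\<close>)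
    define J where "J x = k * \<bar>v t x\<bar> + H x" for x
    have J: "(J has_integral k * F t) {0..1}"
    proof -
      have "((\<lambda>x. \<bar>v t x\<bar>) has_integral F t) {0..1}"
        unfolding F_def using vi[OF tT] by (intro integrable_integral) auto
      from has_integral_add[OF has_integral_mult_right[OF this, of k] H(1)] show ?thesis
        unfolding J_def by simp
    qed
    then have Ji: "J integrable_on {0..1}" by (rule has_integral_integrable)
    have vg: "sgn (v t x) * g t x \<le> J x" if "x \<in> {0..1}" for x
      using H(2)[OF that] by (simp add: v_def g_def J_def k_def profile_def)
    have "continuous_on {0..1} (\<lambda>h. integral {0..h} J)"
      by (rule indefinite_integral_continuous_1[OF Ji])
    then have "((\<lambda>h. integral {0..h} J) \<longlongrightarrow> integral {0..0} J) (at 0 within {0..1})"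
      unfolding continuous_on_def by (rule bspec) simp
    then have "((\<lambda>h. integral {0..h} J) \<longlongrightarrow> 0) (at_right 0)"
      by (simp add: at_within_Icc_at_right)
    then have small: "\<forall>\<^sub>F h in at_right 0. integral {0..h} J > - (e / 3)"
      using e by (intro order_tendstoD) auto
    obtain d where d: "0 < d" "\<And>t s x y. t \<in> {0..T} \<Longrightarrow> s \<in> {0..T} \<Longrightarrow> x \<in> {0..1} \<Longrightarrow> y \<in> {0..1} \<Longrightarrow>
        \<bar>t - s\<bar> < d \<Longrightarrow> \<bar>x - y\<bar> < d \<Longrightarrow> \<bar>g t x - g s y\<bar> \<le> e / 3"
      using uniformly_continuous_rectangle[OF gc e3] by blast
    have "\<forall>\<^sub>F h in at_right 0. 0 < h \<and> h < min (min d t) (min (1/2) (e / (3 * C)))"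
      unfolding eventually_at_right_field using d t C e
      by (intro exI[of _ "min (min d t) (min (1/2) (e / (3 * C)))"]) auto
    with small show "\<forall>\<^sub>F h in at_right 0. F t - F (t - h) \<le> h * (k * F t + e)"
    proof eventually_elim
      case (elim h)
      then have h: "0 < h" "h < d" "h < t" "h < 1/2" "h * C \<le> e / 3" and thT: "t - h \<in> {0..T}"
        using C t by (auto simp: field_simps)
      have inner: "\<bar>v t x\<bar> - \<bar>v (t - h) (x - h)\<bar> \<le> h * (J x + e / 3)" if x: "x \<in> {h..1}" for x
      proof -
        have "\<bar>v t x\<bar> = sgn (v t x) * v t x" by (simp add: abs_sgn mult.commute)
        moreover have "sgn (v t x) * v (t - h) (x - h) \<le> \<bar>v (t - h) (x - h)\<bar>" by (rule sgn_le)
        ultimately have "\<bar>v t x\<bar> - \<bar>v (t - h) (x - h)\<bar> \<le> sgn (v t x) * (v t x - v (t - h) (x - h))"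
          by (simp add: right_diff_distrib)
        also have "\<dots> = sgn (v t x) * (h * g t x) + sgn (v t x) * (v t x - v (t - h) (x - h) - h * g t x)"
          by (simp add: algebra_simps)
        also have "\<dots> \<le> h * J x + h * (e / 3)"
        proof (rule add_mono)
          show "sgn (v t x) * (h * g t x) \<le> h * J x"
            using mult_left_mono[OF vg[of x], of h] x h by (simp add: mult.left_commute)
          have "\<bar>integral {0..h} (\<lambda>s. g (t - s) (x - s)) - (h - 0) * g t x\<bar> \<le> (h - 0) * (e / 3)"
            using h x t by (intro integral_close_to_constant gi d(2)) auto
          moreover have "v t x - v (t - h) (x - h) = integral {0..h} (\<lambda>s. g (t - s) (x - s))"
            using h x t by (intro char) auto
          ultimately have "\<bar>v t x - v (t - h) (x - h) - h * g t x\<bar> \<le> h * (e / 3)" by simp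
          then show "sgn (v t x) * (v t x - v (t - h) (x - h) - h * g t x) \<le> h * (e / 3)"
            using sgn_le[of "v t x" "v t x - v (t - h) (x - h) - h * g t x"] by linarith
        qed
        finally show ?thesis by (simp add: algebra_simps)
      qed
      have edge: "\<bar>v t x\<bar> - \<bar>v (t - h) (x + (1 - h))\<bar> \<le> h * C" if x: "x \<in> {0..h}" for x
      proof -
        have "\<bar>v t x - v (t - x) (x - x)\<bar> \<le> x * C" using x h t by (intro charC) auto
        moreover have "\<bar>v (t - x) 1 - v (t - x - (h - x)) (1 - (h - x))\<bar> \<le> (h - x) * C"
          using x h t by (intro charC) auto
        moreover have "v (t - x) 1 = v (t - x) 0" using x h t by (intro jump) auto
        moreover have "x * C + (h - x) * C = h * C" by (simp add: algebra_simps)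
        ultimately show ?thesis by (simp add: algebra_simps)
      qed
      have Jh: "J integrable_on {h..1}" "integral {0..h} J + integral {h..1} J = k * F t"
        using Henstock_Kurzweil_Integration.integral_combine[OF _ _ Ji, of h] integrable_subinterval_real[OF Ji, of h 1] h
          integral_unique[OF J] by auto
      have s1: "(\<lambda>x. \<bar>v (t - h) (x - h)\<bar>) integrable_on {h..1}"
        and s2: "(\<lambda>x. \<bar>v (t - h) (x + (1 - h))\<bar>) integrable_on {0..h}"
        by (intro integrable_continuous_real continuous_intros continuous_on_rectangleD[OF vc];
            use thT h in \<open>auto intro!: continuous_intros\<close>)+
      have "F (t - h) = integral {0..1 - h} (\<lambda>x. \<bar>v (t - h) x\<bar>) + integral {1 - h..1} (\<lambda>x. \<bar>v (t - h) x\<bar>)"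
        unfolding F_def using h vi[OF thT]
        by (intro Henstock_Kurzweil_Integration.integral_combine[symmetric]) auto
      also have "integral {0..1 - h} (\<lambda>x. \<bar>v (t - h) x\<bar>) = integral {h..1} (\<lambda>x. \<bar>v (t - h) (x - h)\<bar>)"
        using integral_shift_Icc_real[of h 1 "\<lambda>x. \<bar>v (t - h) x\<bar>" "- h"] by (simp add: comp_def)
      also have "integral {1 - h..1} (\<lambda>x. \<bar>v (t - h) x\<bar>) = integral {0..h} (\<lambda>x. \<bar>v (t - h) (x + (1 - h))\<bar>)"
        using integral_shift_Icc_real[of 0 h "\<lambda>x. \<bar>v (t - h) x\<bar>" "1 - h"] by (simp add: comp_def add.commute)
      finally have Fh: "F (t - h) = integral {h..1} (\<lambda>x. \<bar>v (t - h) (x - h)\<bar>) + integral {0..h} (\<lambda>x. \<bar>v (t - h) (x + (1 - h))\<bar>)" .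
      have Ft: "F t = integral {0..h} (\<lambda>x. \<bar>v t x\<bar>) + integral {h..1} (\<lambda>x. \<bar>v t x\<bar>)"
        unfolding F_def using h vi[OF tT]
        by (intro Henstock_Kurzweil_Integration.integral_combine[symmetric]) auto
      have "integral {h..1} (\<lambda>x. \<bar>v t x\<bar>) - integral {h..1} (\<lambda>x. \<bar>v (t - h) (x - h)\<bar>)
          = integral {h..1} (\<lambda>x. \<bar>v t x\<bar> - \<bar>v (t - h) (x - h)\<bar>)"
        using s1 vi[OF tT, of h 1] h by (simp add: integral_diff)
      also have "\<dots> \<le> integral {h..1} (\<lambda>x. h * (J x + e / 3))"
        using inner s1 vi[OF tT, of h 1] h Jh(1)
        by (intro integral_le integrable_diff integrable_on_mult_right integrable_add integrable_const_ivl) auto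
      also have "\<dots> = h * (integral {h..1} J + (1 - h) * (e / 3))"
        using Jh(1) h by (simp add: integral_add integrable_const_ivl)
      finally have part1: "integral {h..1} (\<lambda>x. \<bar>v t x\<bar>) - integral {h..1} (\<lambda>x. \<bar>v (t - h) (x - h)\<bar>)
          \<le> h * (integral {h..1} J + (1 - h) * (e / 3))" .
      have "integral {0..h} (\<lambda>x. \<bar>v t x\<bar>) - integral {0..h} (\<lambda>x. \<bar>v (t - h) (x + (1 - h))\<bar>)
          = integral {0..h} (\<lambda>x. \<bar>v t x\<bar> - \<bar>v (t - h) (x + (1 - h))\<bar>)"
        using s2 vi[OF tT, of 0 h] h by (simp add: integral_diff)
      also have "\<dots> \<le> integral {0..h} (\<lambda>x. h * C)"
        using edge s2 vi[OF tT, of 0 h] h by (intro integral_le integrable_diff integrable_const_ivl) auto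
      also have "\<dots> = h * (h * C)" using h by simp
      also have "\<dots> \<le> h * (e / 3)" using h by (intro mult_left_mono) auto
      finally have part2: "integral {0..h} (\<lambda>x. \<bar>v t x\<bar>) - integral {0..h} (\<lambda>x. \<bar>v (t - h) (x + (1 - h))\<bar>) \<le> h * (e / 3)" .
      have "F t - F (t - h) \<le> h * (integral {h..1} J + (1 - h) * (e / 3) + e / 3)"
        unfolding Ft Fh using part1 part2 by (simp add: algebra_simps)
      also have "\<dots> \<le> h * (k * F t + e)"
      proof (rule mult_left_mono)
        have "(1 - h) * (e / 3) \<le> 1 * (e / 3)" using h e by (intro mult_right_mono) auto
        then show "integral {h..1} J + (1 - h) * (e / 3) + e / 3 \<le> k * F t + e" using Jh(2) elim(1) by linarith
      qed (use h in auto)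
      finally show ?case .
    qed
  qed
  then show ?thesis by (simp add: F_def v_def k_def)
qed


section \<open>Classical solutions and their slopes\<close>

lemma deriv_within_eqI:
  assumes "(f has_real_derivative D) (at x within S)" "at x within S \<noteq> bot"
  shows "deriv_within f S x = D"
  using assms by (intro vector_derivative_within) (auto simp: has_real_derivative_iff_has_vector_derivative)

lemma deriv_within_has_real_derivative:
  assumes "f differentiable_on S" "x \<in> S"
  shows "(f has_real_derivative deriv_within f S x) (at x within S)"
  using assms by (auto simp: differentiable_on_def has_real_derivative_iff_has_vector_derivative
      intro: vector_derivative_works[THEN iffD1])

lemma at_within_unit_interval_nontrivial: "x \<in> {0..1} \<Longrightarrow> at x within {0..1::real} \<noteq> bot"
  by (auto simp: trivial_limit_within intro!: islimpt_closure_open[where s="{0<..<1}"])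

lemma at_within_half_line_nontrivial: "0 \<le> t \<Longrightarrow> at t within {0::real..} \<noteq> bot"
proof -
  assume "0 \<le> t"
  have "at_right t \<le> at t within {0..}" using \<open>0 \<le> t\<close> by (intro at_le) auto
  then show ?thesis using trivial_limit_at_right_real[of t] by (metis bot.extremum_uniqueI)
qed

lemma time_interval_infinity [simp]: "time_interval \<infinity> = {0..}"
  by (auto simp: time_interval_def)

lemma at_within_half_line: "0 \<le> t \<Longrightarrow> t < T \<Longrightarrow> at t within {0..T} = at t within {0::real..}"
  by (rule at_within_nhd[of t "{..<T}"]) auto

lemma C2_realD:
  assumes "C2_real K"
  shows "(K has_real_derivative deriv K x) (at x)"
    and "(deriv K has_real_derivative deriv (deriv K) x) (at x)"
    and "continuous_on UNIV (deriv (deriv K))"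
proof -
  have "K field_differentiable at x" "deriv K field_differentiable at x"
    using assms by (auto simp: C2_real_def differentiable_on_def real_differentiable_def field_differentiable_def)
  then show "(K has_real_derivative deriv K x) (at x)" "(deriv K has_real_derivative deriv (deriv K) x) (at x)"
    by (auto simp: DERIV_deriv_iff_field_differentiable)
  show "continuous_on UNIV (deriv (deriv K))" using assms by (simp add: C2_real_def)
qed

lemma deriv_within_nonneg_if_mono:
  assumes f: "(f has_real_derivative D) (at x within {0..1})" and x: "x \<in> {0..1}" and mono: "mono_on {0..1} f"
  shows "0 \<le> D"
proof (rule ccontr)
  assume "\<not> 0 \<le> D"
  then have D: "D < 0" by simp
  show False
  proof (cases "x < 1")
    case True
    obtain d where d: "d > 0" "\<And>h. h > 0 \<Longrightarrow> x + h \<in> {0..1} \<Longrightarrow> h < d \<Longrightarrow> f x > f (x + h)"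
      using has_real_derivative_neg_dec_right[OF f D] by blast
    define h where "h = min (d / 2) (1 - x)"
    have "0 < h" "h < d" "x + h \<in> {0..1}" using d True x by (auto simp: h_def min_def)
    then show False using d(2)[of h] mono x by (auto simp: monotone_on_def not_le[symmetric])
  next
    case False
    then have "x = 1" using x by simp
    obtain d where d: "d > 0" "\<And>h. h > 0 \<Longrightarrow> x - h \<in> {0..1} \<Longrightarrow> h < d \<Longrightarrow> f x < f (x - h)"
      using has_real_derivative_neg_dec_left[OF f D] by blast
    define h where "h = min (d / 2) 1"
    have "0 < h" "h < d" "x - h \<in> {0..1}" using d \<open>x = 1\<close> by (auto simp: h_def min_def)
    then show False using d(2)[of h] mono x by (auto simp: monotone_on_def not_le[symmetric])
  qed
qed

text \<open>The slope of the profile is its derivative, and the time derivative follows from the mass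
  balance; the equation at \<open>\<eta> = 1\<close> reads \<open>1 / N = u t 1 - K P\<close>.\<close>

theorem classical_solution_of_slope:
  assumes C2: "C2_real K"
    and u: "\<And>T. slope_solution K (K P - K 0) T u"
    and nonneg: "\<And>t x. 0 \<le> t \<Longrightarrow> x \<in> {0..1} \<Longrightarrow> 0 \<le> u t x"
    and ends: "\<And>t. 0 \<le> t \<Longrightarrow> K P < u t 1"
    and init: "\<And>x. x \<in> {0..1} \<Longrightarrow> profile u 0 x = Qi x"
  shows "classical_solution K P Qi \<infinity> (profile u) (\<lambda>t. 1 / (u t 1 - K P))"
proof -
  note K = C2_realD[OF C2]
  have contK': "continuous_on UNIV (deriv K)"
    using K(2) by (intro DERIV_continuous_on) (auto intro: has_field_derivative_at_within)
  have uT: "continuous_on ({0..T} \<times> {0..1}) (\<lambda>(t, x). u t x)" for T using u[of T] by (simp add: slope_solution_def)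
  have uc: "continuous_on ({0..} \<times> {0..1}) (\<lambda>(t, x). u t x)"
  proof -
    have "continuous (at z within {0..} \<times> {0..1}) (\<lambda>(t, x). u t x)" if "z \<in> {0..} \<times> {0..1}" for z :: "real \<times> real"
    proof -
      have z: "z \<in> {0..fst z + 1} \<times> {0..1}" using that by auto
      have "continuous (at z within {0..fst z + 1} \<times> {0..1}) (\<lambda>(t, x). u t x)"
        using uT[of "fst z + 1"] z unfolding continuous_on_eq_continuous_within by blast
      moreover have "at z within {0..fst z + 1} \<times> {0..1} = at z within {0..} \<times> {0..1}"
        by (rule at_within_nhd[of z "{..<fst z + 1} \<times> UNIV"]) (auto simp: open_Times mem_Times_iff)
      ultimately show ?thesis by simp
    qed
    then show ?thesis unfolding continuous_on_eq_continuous_within by blast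
  qed
  note pc = profile_continuous[OF uc]
  have us: "continuous_on {0..1} (u t)" if "0 \<le> t" for t
    by (rule slice_continuous[OF uc]) (use that in auto)
  have d1: "(profile u t has_real_derivative u t x) (at x within {0..1})" if "0 \<le> t" "x \<in> {0..1}" for t x
    by (rule profile_has_derivative[OF us that(2)]) (use that in auto)
  have d2: "((\<lambda>t. profile u t x) has_real_derivative (u t 0 - K 0 + K (profile u t x) - u t x)) (at t within {0..})"
    if "0 \<le> t" "x \<in> {0..1}" for t x
    using profile_time_derivative[OF K(1) contK' u[of "t + 1"], of t x] that at_within_half_line[of t "t + 1"] by simp
  have e1: "d_eta (profile u) t x = u t x" if "0 \<le> t" "x \<in> {0..1}" for t x
    unfolding d_eta_def using d1[OF that] that by (intro deriv_within_eqI at_within_unit_interval_nontrivial)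
  have e2: "d_tau \<infinity> (profile u) t x = u t 0 - K 0 + K (profile u t x) - u t x" if "0 \<le> t" "x \<in> {0..1}" for t x
    unfolding d_tau_def time_interval_infinity
    using d2[OF that] that by (intro deriv_within_eqI at_within_half_line_nontrivial)
  have jump: "u t 1 - u t 0 = K P - K 0" if "0 \<le> t" for t
    using u[of t] that by (auto simp: slope_solution_def)
  have "C1_strip \<infinity> (profile u)"
    unfolding C1_strip_def time_interval_infinity
  proof (intro conjI ballI)
    show "(\<lambda>t. profile u t x) differentiable_on {0..}" if "x \<in> {0..1}" for x
      using d2 that by (fastforce simp: differentiable_on_def real_differentiable_def)
    show "profile u t differentiable_on {0..1}" if "t \<in> {0..}" for t
      using d1 that by (fastforce simp: differentiable_on_def real_differentiable_def)
    have "continuous_on ({0..} \<times> {0..1}) (\<lambda>(t, x). u t 0 - K 0 + K (profile u t x) - u t x)"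
      unfolding case_prod_unfold
      by (intro continuous_on_diff continuous_on_add continuous_on_const K_continuous[OF K(1) contK']
          continuous_on_rectangleD[OF uc] continuous_on_rectangleD[OF pc]) (auto intro!: continuous_intros)
    then show "continuous_on ({0..} \<times> {0..1}) (\<lambda>(t, x). d_tau \<infinity> (profile u) t x)"
      by (rule continuous_on_eq) (auto simp: e2)
    show "continuous_on ({0..} \<times> {0..1}) (\<lambda>(t, x). d_eta (profile u) t x)"
      using uc by (rule continuous_on_eq) (auto simp: e1)
  qed
  moreover have "mono_on {0..1} (profile u t)" if "0 \<le> t" for t
    using profile_between[of u t, OF us nonneg] that by (intro monotone_onI) auto
  moreover have "continuous_on {0..} (\<lambda>t. 1 / (u t 1 - K P))"
    using ends by (intro continuous_intros continuous_on_rectangleD[OF uc]) force+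
  moreover have "d_tau \<infinity> (profile u) t x + d_eta (profile u) t x = u t 1 - K P + K (profile u t x)"
    if "0 \<le> t" "x \<in> {0..1}" for t x
    using e1[OF that] e2[OF that] jump[OF that(1)] by simp
  ultimately show ?thesis
    unfolding classical_solution_def time_interval_infinity
    using ends e1[of _ 1] init by (auto simp: less_imp_le)
qed

text \<open>Conversely, since \<open>Q\<close> is \<open>C\<^sup>1\<close>, the equation integrated along characteristics may be
  differentiated in \<open>\<eta>\<close> under the integral sign.\<close>

theorem slope_of_classical_solution:
  assumes C2: "C2_real K" and L: "\<And>x. \<bar>deriv K x\<bar> \<le> L"
    and sol: "classical_solution K P Qi \<infinity> Q N" and Qi1: "Qi 1 = P"
  shows "slope_solution K (K P - K 0) T (d_eta Q)"
    and "0 \<le> t \<Longrightarrow> x \<in> {0..1} \<Longrightarrow> 0 \<le> d_eta Q t x"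
    and "0 \<le> t \<Longrightarrow> x \<in> {0..1} \<Longrightarrow> profile (d_eta Q) t x = Q t x"
    and "0 \<le> t \<Longrightarrow> profile (d_eta Q) t 1 = P"
proof -
  note K = C2_realD[OF C2]
  have contK': "continuous_on UNIV (deriv K)"
    using K(2) by (intro DERIV_continuous_on) (auto intro: has_field_derivative_at_within)
  define u where "u = d_eta Q"
  define w where "w = d_tau \<infinity> Q"
  have uc: "continuous_on ({0..} \<times> {0..1}) (\<lambda>(t, x). u t x)" and wc: "continuous_on ({0..} \<times> {0..1}) (\<lambda>(t, x). w t x)"
    using sol by (auto simp: classical_solution_def C1_strip_def u_def w_def)
  have d1: "(Q t has_real_derivative u t x) (at x within {0..1})" if "0 \<le> t" "x \<in> {0..1}" for t x
    using sol that by (auto simp: classical_solution_def C1_strip_def u_def d_eta_def intro!: deriv_within_has_real_derivative)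
  have d2: "((\<lambda>t. Q t x) has_real_derivative w t x) (at t within {0..})" if "0 \<le> t" "x \<in> {0..1}" for t x
    unfolding w_def d_tau_def time_interval_infinity
    using sol that by (intro deriv_within_has_real_derivative) (auto simp: classical_solution_def C1_strip_def)
  have Q0: "Q t 0 = 0" if "0 \<le> t" for t using sol that by (auto simp: classical_solution_def)
  have N: "1 / N t = u t 1 - K P" if "0 \<le> t" for t using sol that by (auto simp: classical_solution_def u_def)
  have us: "continuous_on {0..1} (u t)" if "0 \<le> t" for t
    by (rule slice_continuous[OF uc]) (use that in auto)
  show nonneg: "0 \<le> d_eta Q t x" if "0 \<le> t" "x \<in> {0..1}" for t x
    using deriv_within_nonneg_if_mono[OF d1[OF that] that(2)] sol that by (auto simp: classical_solution_def u_def)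
  have prof: "profile u t x = Q t x" if "0 \<le> t" "x \<in> {0..1}" for t x
  proof -
    have "(u t has_integral (Q t x - Q t 0)) {0..x}"
      by (rule has_real_integral_derivative) (use that in \<open>auto intro!: DERIV_subset[OF d1]\<close>)
    then show ?thesis using Q0[OF that(1)] by (simp add: profile_def integral_unique)
  qed
  then show "profile (d_eta Q) t x = Q t x" if "0 \<le> t" "x \<in> {0..1}" for t x using that by (simp add: u_def)
  have pc: "continuous_on ({0..} \<times> {0..1}) (\<lambda>(t, x). Q t x)"
    using profile_continuous[OF uc] by (rule continuous_on_eq) (auto simp: prof)
  have pde: "w t x + u t x = u t 1 - K P + K (Q t x)" if "0 \<le> t" "x \<in> {0..1}" for t x
  proof -
    have "w t x + u t x - (u t 1 - K P + K (Q t x)) = 0"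
    proof (rule continuous_constant_on_closure[of "{0<..<1}" "\<lambda>x. w t x + u t x - (u t 1 - K P + K (Q t x))"])
      have "continuous_on {0..1} (\<lambda>x. w t x + u t x - (u t 1 - K P + K (Q t x)))"
        using that(1)
        by (intro continuous_on_diff continuous_on_add continuous_on_const K_continuous[OF K(1) contK']
          continuous_on_rectangleD[OF uc] continuous_on_rectangleD[OF pc] continuous_on_rectangleD[OF wc])
         (auto intro!: continuous_intros)
      then show "continuous_on (closure {0<..<1}) (\<lambda>x. w t x + u t x - (u t 1 - K P + K (Q t x)))" by simp
      show "x \<in> closure {0<..<1}" using that by simp
      fix x :: real assume "x \<in> {0<..<1}"
      then have "w t x + u t x = 1 / N t + K (Q t x)"
        using sol that by (auto simp: classical_solution_def u_def w_def)
      then show "w t x + u t x - (u t 1 - K P + K (Q t x)) = 0" using N[OF that(1)] by simp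
    qed
    then show ?thesis by simp
  qed
  have jump: "u t 1 - u t 0 = K P - K 0" if "0 \<le> t" for t
  proof -
    have "((\<lambda>t. Q t 0) has_real_derivative 0) (at t within {0..})"
      by (rule has_field_derivative_transform_within[OF DERIV_const, of 1]) (use Q0 that in auto)
    then have "w t 0 = 0"
      unfolding w_def d_tau_def time_interval_infinity
      using that by (intro deriv_within_eqI at_within_half_line_nontrivial)
    then show ?thesis using pde[of t 0] Q0[OF that] that by simp
  qed
  have Q1: "Q t 1 = P" if "0 \<le> t" for t
  proof (rule equilibrium_invariant[OF that, of "\<lambda>t. Q t 1" "\<lambda>y. K y - K P" L P])
    fix s assume s: "s \<in> {0..t}"
    have "w s 1 = K (Q s 1) - K P" using pde[of s 1] s by simp
    then show "((\<lambda>t. Q t 1) has_real_derivative K (Q s 1) - K P) (at s within {0..t})"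
      using d2[of s 1] s by (auto intro: DERIV_subset)
  next
    fix y
    have "norm (K y - K P) \<le> L * norm (y - P)"
      by (rule field_differentiable_bound[of UNIV]) (use K L in auto)
    then show "\<bar>K y - K P\<bar> \<le> L * \<bar>y - P\<bar>" by simp
  next
    show "Q 0 1 = P" using sol Qi1 by (auto simp: classical_solution_def)
  qed
  then show "profile (d_eta Q) t 1 = P" if "0 \<le> t" for t using prof[of t 1] that by (simp add: u_def)
  have total: "((\<lambda>(t, x). Q t x) has_derivative (\<lambda>(a, b). w t x * a + u t x * b)) (at (t, x) within {0..} \<times> {0..1})"
    if "0 \<le> t" "x \<in> {0..1}" for t x
  proof -
    have "((\<lambda>(t, x). Q t x) has_derivative (\<lambda>(a, b). w t x * a + blinfun_apply (blinfun_mult_right (u t x)) b))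
        (at (t, x) within {0..} \<times> {0..1})"
    proof (rule has_derivative_partialsI)
      show "((\<lambda>t. Q t x) has_derivative (*) (w t x)) (at t within {0..})"
        using d2[OF that] by (simp add: has_field_derivative_def)
      show "(Q s has_derivative blinfun_apply (blinfun_mult_right (u s y))) (at y within {0..1})"
        if "s \<in> {0..}" "y \<in> {0..1}" for s y
        using d1[of s y] that by (simp add: has_field_derivative_def)
      have "continuous_on ({0..} \<times> {0..1}) (\<lambda>z. blinfun_mult_right ((\<lambda>(t, x). u t x) z))"
        by (rule bounded_linear.continuous_on[OF bounded_linear_blinfun_mult_right uc])
      then show "continuous (at (t, x) within {0..} \<times> {0..1}) (\<lambda>(t, x). blinfun_mult_right (u t x))"
        using that by (auto simp: continuous_on_eq_continuous_within case_prod_unfold)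
    qed (use that in auto)
    then show ?thesis by simp
  qed
  have along: "Q t x - Q (t - h) (x - h) = integral {0..h} (\<lambda>s. u (t - s) 1 - K P + K (Q (t - s) (x - s)))"
    if h: "0 \<le> h" "h \<le> t" "h \<le> x" "x \<le> 1" for t x h
  proof -
    have "((\<lambda>s. u (t - s) 1 - K P + K (Q (t - s) (x - s))) has_integral
        (- Q (t - h) (x - h) - (- Q (t - 0) (x - 0)))) {0..h}"
    proof (rule has_real_integral_derivative[OF h(1)])
      fix s assume s: "s \<in> {0..h}"
      have "((\<lambda>s. (t - s, x - s)) has_derivative (\<lambda>r. (- r, - r))) (at s within {0..h})"
        by (auto intro!: derivative_eq_intros)
      moreover have "((\<lambda>(t, x). Q t x) has_derivative (\<lambda>(a, b). w (t - s) (x - s) * a + u (t - s) (x - s) * b))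
          (at (t - s, x - s) within (\<lambda>s. (t - s, x - s)) ` {0..h})"
        by (rule has_derivative_subset[OF total]) (use s h in auto)
      ultimately have "((\<lambda>s. (\<lambda>(t, x). Q t x) (t - s, x - s)) has_derivative
          (\<lambda>r. (\<lambda>(a, b). w (t - s) (x - s) * a + u (t - s) (x - s) * b) (- r, - r))) (at s within {0..h})"
        by (rule has_derivative_in_compose)
      then have "((\<lambda>s. Q (t - s) (x - s)) has_derivative (\<lambda>r. (- (w (t - s) (x - s) + u (t - s) (x - s))) * r)) (at s within {0..h})"
        by (simp add: algebra_simps)
      then have dd: "((\<lambda>s. Q (t - s) (x - s)) has_real_derivative - (w (t - s) (x - s) + u (t - s) (x - s))) (at s within {0..h})"
        unfolding has_field_derivative_def .
      have eq: "w (t - s) (x - s) + u (t - s) (x - s) = u (t - s) 1 - K P + K (Q (t - s) (x - s))"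
        using pde[of "t - s" "x - s"] s h by simp
      show "((\<lambda>s. - Q (t - s) (x - s)) has_real_derivative u (t - s) 1 - K P + K (Q (t - s) (x - s))) (at s within {0..h})"
        using DERIV_minus[OF dd] by (simp only: minus_minus eq)
    qed
    then show ?thesis by (simp add: integral_unique)
  qed
  have char: "u t x - u (t - h) (x - h) = integral {0..h} (\<lambda>s. deriv K (Q (t - s) (x - s)) * u (t - s) (x - s))"
    if h: "0 \<le> h" "h \<le> t" "h \<le> x" "x \<le> 1" "h < 1" for t x h
  proof -
    define f where "f y s = u (t - s) 1 - K P + K (Q (t - s) (y - s))" for y s
    have cs: "continuous_on ({h..1} \<times> {0..h}) (\<lambda>(y, s). u (t - s) (y - s))"
      "continuous_on ({h..1} \<times> {0..h}) (\<lambda>(y, s). Q (t - s) (y - s))"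
      unfolding case_prod_unfold
      by (rule continuous_on_rectangleD[OF uc] continuous_on_rectangleD[OF pc]; use h in \<open>auto intro!: continuous_intros\<close>)+
    have "((\<lambda>y. integral (cbox 0 h) (f y)) has_field_derivative
        integral (cbox 0 h) (\<lambda>s. deriv K (Q (t - s) (x - s)) * u (t - s) (x - s))) (at x within {h..1})"
    proof (rule leibniz_rule_field_derivative)
      fix y s assume ys: "y \<in> {h..1}" "s \<in> cbox 0 h"
      have "(Q (t - s) has_real_derivative u (t - s) (y - s)) (at (y - s) within (\<lambda>y. y - s) ` {h..1})"
        by (rule DERIV_subset[OF d1]) (use ys h in auto)
      moreover have "((\<lambda>y. y - s) has_real_derivative 1) (at y within {h..1})" by (auto intro!: derivative_eq_intros)
      ultimately have "((\<lambda>y. Q (t - s) (y - s)) has_real_derivative u (t - s) (y - s) * 1) (at y within {h..1})"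
        using DERIV_image_chain[of "Q (t - s)" "u (t - s) (y - s)" "\<lambda>y. y - s" y "{h..1}" 1] by (simp add: comp_def)
      from has_real_derivative_compose_within[OF this K(1)]
      show "((\<lambda>y. f y s) has_field_derivative deriv K (Q (t - s) (y - s)) * u (t - s) (y - s)) (at y within {h..1})"
        unfolding f_def by (auto intro!: derivative_eq_intros)
    next
      fix y assume "y \<in> {h..1}"
      then show "f y integrable_on cbox 0 h"
        unfolding f_def cbox_interval
        by (intro integrable_continuous_real continuous_on_diff continuous_on_add continuous_on_const K_continuous[OF K(1) contK']
          continuous_on_rectangleD[OF uc] continuous_on_rectangleD[OF pc]) (use h in \<open>auto intro!: continuous_intros\<close>)
    next
      show "continuous_on ({h..1} \<times> cbox 0 h) (\<lambda>(y, s). deriv K (Q (t - s) (y - s)) * u (t - s) (y - s))"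
        using cs unfolding case_prod_unfold cbox_interval by (intro continuous_on_mult K_continuous[OF K(1) contK'])
    qed (use h in auto)
    moreover have "((\<lambda>y. integral (cbox 0 h) (f y)) has_field_derivative u t x - u (t - h) (x - h)) (at x within {h..1})"
    proof -
      have "(Q (t - h) has_real_derivative u (t - h) (x - h)) (at (x - h) within (\<lambda>y. y - h) ` {h..1})"
        by (rule DERIV_subset[OF d1]) (use h in auto)
      moreover have "((\<lambda>y. y - h) has_real_derivative 1) (at x within {h..1})" by (auto intro!: derivative_eq_intros)
      ultimately have a: "((\<lambda>y. Q (t - h) (y - h)) has_real_derivative u (t - h) (x - h)) (at x within {h..1})"
        using DERIV_image_chain[of "Q (t - h)" "u (t - h) (x - h)" "\<lambda>y. y - h" x "{h..1}" 1] by (simp add: comp_def)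
      have b: "(Q t has_real_derivative u t x) (at x within {h..1})"
        by (rule DERIV_subset[OF d1]) (use h in auto)
      show ?thesis
        by (rule has_field_derivative_transform_within[OF DERIV_diff[OF b a], of 1])
          (use h along in \<open>auto simp: f_def[abs_def] cbox_interval\<close>)
    qed
    ultimately show ?thesis
      using vector_derivative_unique_within_closed_interval[of h 1 x] h
      by (auto simp: has_real_derivative_iff_has_vector_derivative)
  qed
  show "slope_solution K (K P - K 0) T (d_eta Q)"
    unfolding slope_solution_def
  proof (intro conjI ballI allI impI)
    show "continuous_on ({0..T} \<times> {0..1}) (\<lambda>(t, x). d_eta Q t x)"
      by (rule continuous_on_subset[OF uc[unfolded u_def]]) auto
    show "d_eta Q t 1 - d_eta Q t 0 = K P - K 0" if "t \<in> {0..T}" for t using jump[of t] that by (simp add: u_def)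
    fix t x h :: real assume h: "0 \<le> h" "h \<le> t" "t \<le> T" "h \<le> x" "x \<le> 1" "h < 1"
    have "integral {0..h} (\<lambda>s. deriv K (Q (t - s) (x - s)) * u (t - s) (x - s))
        = integral {0..h} (\<lambda>s. deriv K (profile u (t - s) (x - s)) * u (t - s) (x - s))"
      by (intro integral_cong) (use h prof in auto)
    then show "d_eta Q t x - d_eta Q (t - h) (x - h) =
        integral {0..h} (\<lambda>s. deriv K (profile (d_eta Q) (t - s) (x - s)) * d_eta Q (t - s) (x - s))"
      using char[of h t x] h by (simp add: u_def)
  qed
qed


text \<open>The initial data may differ, so that one of the solutions can be a steady state.\<close>

theorem classical_L1_contraction:
  assumes C2: "C2_real K" and L: "\<And>x. \<bar>deriv K x\<bar> \<le> L"
    and sol1: "classical_solution K P Qi1 \<infinity> Q1 N1" "Qi1 1 = P"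
    and sol2: "classical_solution K P Qi2 \<infinity> Q2 N2" "Qi2 1 = P"
    and "0 \<le> t"
  shows "integral {0..1} (\<lambda>x. \<bar>d_eta Q1 t x - d_eta Q2 t x\<bar>) \<le>
    exp (k_max K P * t) * integral {0..1} (\<lambda>x. \<bar>d_eta Q1 0 x - d_eta Q2 0 x\<bar>)"
  using slope_of_classical_solution[OF C2 L sol1] slope_of_classical_solution[OF C2 L sol2] \<open>0 \<le> t\<close>
  by (intro slope_L1_contraction[OF C2_realD[OF C2]]) auto

lemma d_eta_slice_continuous:
  assumes "classical_solution K P Qi \<infinity> Q N" "0 \<le> t"
  shows "continuous_on {0..1} (d_eta Q t)"
  by (rule slice_continuous[of "{0..}"]) (use assms in \<open>auto simp: classical_solution_def C1_strip_def\<close>)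

lemma continuous_eq_if_L1_distance_nonpos:
  fixes f g :: "real \<Rightarrow> real"
  assumes "continuous_on {0..1} f" "continuous_on {0..1} g"
    "integral {0..1} (\<lambda>x. \<bar>f x - g x\<bar>) \<le> 0" "x \<in> {0..1}"
  shows "f x = g x"
proof -
  have c: "continuous_on {0..1} (\<lambda>x. \<bar>f x - g x\<bar>)" using assms by (intro continuous_intros)
  then have "0 \<le> integral {0..1} (\<lambda>x. \<bar>f x - g x\<bar>)"
    by (intro Henstock_Kurzweil_Integration.integral_nonneg integrable_continuous_real) auto
  then have "integral {0..1} (\<lambda>x. \<bar>f x - g x\<bar>) = 0" using assms(3) by simp
  then have "\<forall>x\<in>{0..1}. \<bar>f x - g x\<bar> = 0"
    using integral_eq_0_iff[OF c] by auto
  then show ?thesis using assms(4) by simp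
qed

lemma classical_solutions_agree:
  assumes C2: "C2_real K" and L: "\<And>x. \<bar>deriv K x\<bar> \<le> L"
    and sol1: "classical_solution K P Qi1 \<infinity> Q1 N1" "Qi1 1 = P"
    and sol2: "classical_solution K P Qi2 \<infinity> Q2 N2" "Qi2 1 = P"
    and t: "0 \<le> t" and close: "integral {0..1} (\<lambda>x. \<bar>d_eta Q1 t x - d_eta Q2 t x\<bar>) \<le> 0"
  shows "N1 t = N2 t" and "x \<in> {0..1} \<Longrightarrow> Q1 t x = Q2 t x"
proof -
  have eq: "d_eta Q1 t x = d_eta Q2 t x" if "x \<in> {0..1}" for x
    using continuous_eq_if_L1_distance_nonpos[OF d_eta_slice_continuous[OF sol1(1) t] d_eta_slice_continuous[OF sol2(1) t] close that] .
  have "1 / N1 t = 1 / N2 t"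
    using sol1(1) sol2(1) t eq[of 1] by (auto simp: classical_solution_def)
  then show "N1 t = N2 t" by simp
  show "Q1 t x = Q2 t x" if x: "x \<in> {0..1}"
  proof -
    have "profile (d_eta Q1) t x = profile (d_eta Q2) t x"
      unfolding profile_def using x eq by (intro integral_cong) auto
    then show ?thesis
      using slope_of_classical_solution(3)[OF C2 L sol1 t x] slope_of_classical_solution(3)[OF C2 L sol2 t x] by simp
  qed
qed

lemma L1_norm_continuous:
  assumes "continuous_on {0..1} f"
  shows "L1_norm f = integral {0..1} (\<lambda>x. \<bar>f x\<bar>)"
proof -
  have "set_integrable lborel {0..1} (\<lambda>x. \<bar>f x\<bar>)"
    using assms by (intro borel_integrable_atLeastAtMost' continuous_intros)
  then have "set_integrable lborel {0<..<1} (\<lambda>x. \<bar>f x\<bar>)"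
    by (rule set_integrable_subset) auto
  then show ?thesis
    unfolding L1_norm_def by (simp add: set_borel_integral_eq_integral(2) integral_open_interval_real)
qed

section \<open>Steady states\<close>

lemma linear_ode_nonneg:
  fixes y a :: "real \<Rightarrow> real"
  assumes y: "\<And>x. x \<in> {0..1} \<Longrightarrow> (y has_real_derivative a x * y x) (at x within {0..1})"
    and a: "continuous_on {0..1} a" and "0 \<le> y 0" and x: "x \<in> {0..1}"
  shows "0 \<le> y x"
proof -
  define A where "A x = integral {0..x} a" for x
  have A: "(A has_real_derivative a x) (at x within {0..1})" if "x \<in> {0..1}" for x
    unfolding A_def by (rule integral_has_real_derivative[OF a that])
  have "((\<lambda>x. exp (- A x) * y x) has_real_derivative 0) (at x within {0..1})" if "x \<in> {0..1}" for x
    by (rule derivative_eq_intros A[OF that] y[OF that] refl | simp)+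
  then obtain c where c: "\<And>x. x \<in> {0..1} \<Longrightarrow> exp (- A x) * y x = c"
    using has_field_derivative_zero_constant[of "{0..1}" "\<lambda>x. exp (- A x) * y x"] by auto
  have "exp (- A x) * y x = exp (- A 0) * y 0" using c[OF x] c[of 0] by simp
  also have "\<dots> \<ge> 0" using assms by simp
  finally show ?thesis by (simp add: zero_le_mult_iff)
qed

text \<open>A steady state increases: its derivative \<open>y = K Q\<^sup>* + 1 / N\<^sup>*\<close> solves the linear equation
  \<open>y' = K' Q\<^sup>* * y\<close> and is positive at \<open>0\<close>.\<close>

lemma steady_state_is_classical_solution:
  assumes C2: "C2_real K" and "0 \<le> K 0" and s: "steady_state K P Qs Ns"
  shows "classical_solution K P Qs \<infinity> (\<lambda>_. Qs) (\<lambda>_. Ns)"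
proof -
  note K = C2_realD[OF C2]
  have contK': "continuous_on UNIV (deriv K)"
    using K(2) by (intro DERIV_continuous_on) (auto intro: has_field_derivative_at_within)
  have dQ: "(Qs has_real_derivative K (Qs x) + 1 / Ns) (at x within {0..1})" if "x \<in> {0..1}" for x
    using s that deriv_within_has_real_derivative[of Qs "{0..1}" x] by (auto simp: steady_state_def C1_on_def)
  have Qc: "continuous_on {0..1} Qs" using dQ by (rule DERIV_continuous_on)
  have "0 \<le> K (Qs x) + 1 / Ns" if "x \<in> {0..1}" for x
  proof (rule linear_ode_nonneg[of "\<lambda>x. K (Qs x) + 1 / Ns" "\<lambda>x. deriv K (Qs x)", OF _ _ _ that])
    show "((\<lambda>x. K (Qs x) + 1 / Ns) has_real_derivative deriv K (Qs x) * (K (Qs x) + 1 / Ns)) (at x within {0..1})"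
      if "x \<in> {0..1}" for x
      using has_real_derivative_compose_within[OF dQ[OF that] K(1)] by (auto intro!: derivative_eq_intros)
    show "continuous_on {0..1} (\<lambda>x. deriv K (Qs x))" by (rule K_continuous(2)[OF K(1) contK' Qc])
    show "0 \<le> K (Qs 0) + 1 / Ns" using s \<open>0 \<le> K 0\<close> by (auto simp: steady_state_def)
  qed
  then have mono: "mono_on {0..1} Qs"
  proof (intro monotone_onI)
    fix x y :: real assume xy: "x \<in> {0..1}" "y \<in> {0..1}" "x \<le> y"
      and nonneg: "\<And>x. x \<in> {0..1} \<Longrightarrow> 0 \<le> K (Qs x) + 1 / Ns"
    have "((\<lambda>x. K (Qs x) + 1 / Ns) has_integral (Qs y - Qs x)) {x..y}"
      by (rule has_real_integral_derivative) (use xy in \<open>auto intro!: DERIV_subset[OF dQ]\<close>)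
    then have "0 \<le> Qs y - Qs x" by (rule has_integral_nonneg) (use xy nonneg in auto)
    then show "Qs x \<le> Qs y" by simp
  qed
  have e: "d_eta (\<lambda>_. Qs) t x = deriv_within Qs {0..1} x" for t x by (simp add: d_eta_def)
  have "d_tau \<infinity> (\<lambda>_. Qs) t x = 0" if "0 \<le> t" for t x
    unfolding d_tau_def time_interval_infinity
    using that by (intro deriv_within_eqI at_within_half_line_nontrivial DERIV_const)
  moreover have "C1_strip \<infinity> (\<lambda>_. Qs)"
    unfolding C1_strip_def time_interval_infinity
  proof (intro conjI ballI)
    show "continuous_on ({0..} \<times> {0..1}) (\<lambda>(t, x). d_tau \<infinity> (\<lambda>_. Qs) t x)"
      by (rule continuous_on_eq[OF continuous_on_const[of _ 0]]) (auto simp: calculation)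
    have "continuous_on {0..1} (deriv_within Qs {0..1})" using s by (simp add: steady_state_def C1_on_def)
    then show "continuous_on ({0..} \<times> {0..1}) (\<lambda>(t, x). d_eta (\<lambda>_. Qs) t x)"
      unfolding e case_prod_unfold by (rule continuous_on_compose2) (auto intro!: continuous_intros)
  qed (use s in \<open>auto simp: steady_state_def C1_on_def\<close>)
  ultimately show ?thesis
    using s mono unfolding classical_solution_def e by (auto simp: steady_state_def)
qed

text \<open>Separating variables, \<open>Q\<^sup>*\<close> is the inverse of \<open>\<phi> \<mapsto> \<integral>\<^sub>0\<^sup>\<phi> 1 / (K + M)\<close>, where \<open>M = 1 / N\<^sup>*\<close> is chosen such
  that this function maps \<open>[0,P]\<close> onto \<open>[0,1]\<close>; such an \<open>M\<close> exists by continuity, because the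
  integral over \<open>[0,P]\<close> exceeds \<open>1\<close> for \<open>M = 0\<close> and is at most \<open>1\<close> for \<open>M = P\<close>. Freezing \<open>K\<close>
  outside \<open>[0,P]\<close> makes the function to be inverted differentiable on a neighbourhood of \<open>[0,P]\<close>.\<close>

theorem steady_state_exists:
  fixes K :: "real \<Rightarrow> real"
  assumes K: "continuous_on UNIV K" and P: "0 < P" and pos: "\<And>y. y \<in> {0..P} \<Longrightarrow> 0 < K y"
    and int: "integral {0..P} (\<lambda>y. 1 / K y) > 1"
  obtains Qs Ns where "steady_state K P Qs Ns"
proof -
  define k where "k y = K (max 0 (min P y))" for y
  have kK: "k y = K y" if "y \<in> {0..P}" for y using that by (simp add: k_def)
  have k0: "0 < k y" for y unfolding k_def using P by (intro pos) auto
  have kc: "continuous_on S k" for S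
    unfolding k_def by (intro continuous_on_compose2[OF K] continuous_intros) auto
  define I where "I M = integral {0..P} (\<lambda>y. 1 / (k y + M))" for M
  have kM: "k y + M \<noteq> 0" "0 < k y + M" if "0 \<le> M" for y M using k0[of y] that by auto
  have I0: "I 0 = integral {0..P} (\<lambda>y. 1 / K y)"
    unfolding I_def by (intro integral_cong) (simp add: kK)
  have "\<exists>M\<ge>0. M \<le> P \<and> I M = 1"
  proof (rule IVT2')
    show "1 \<le> I 0" using int I0 by simp
    have ci: "continuous_on {0..P} (\<lambda>y. 1 / (k y + P))"
      using kM[of P] P by (intro continuous_intros kc) auto
    have "I P \<le> integral {0..P} (\<lambda>y. 1 / P)"
      unfolding I_def using k0 P
      by (intro integral_le integrable_continuous_real ci continuous_intros) (auto intro!: divide_left_mono simp: less_imp_le add_pos_pos)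
    then show "I P \<le> 1" using P by simp
    have "continuous_on ({0..P} \<times> cbox 0 P) (\<lambda>(M, y). 1 / (k y + M))"
      unfolding case_prod_unfold using kM
      by (intro continuous_intros continuous_on_compose2[OF kc[of UNIV]]) auto
    from integral_continuous_on_param[OF this] show "continuous_on {0..P} I" by (simp add: I_def)
  qed (use P in auto)
  then obtain M where M: "0 \<le> M" "I M = 1" by auto
  have "M \<noteq> 0"
  proof
    assume "M = 0"
    with M int I0 show False by simp
  qed
  with M have M0: "0 < M" by simp
  have fc: "continuous_on S (\<lambda>y. 1 / (k y + M))" for S
    using kM[OF M(1)] by (intro continuous_intros kc) auto
  define H where "H y = integral {-1..y} (\<lambda>y. 1 / (k y + M)) - integral {-1..0} (\<lambda>y. 1 / (k y + M))" for y
  have dHw: "(H has_real_derivative 1 / (k y + M)) (at y within {-1..P + 1})" if "y \<in> {-1..P + 1}" for y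
    unfolding H_def using integral_has_real_derivative[OF fc that] by (auto intro!: derivative_eq_intros)
  have dH: "(H has_real_derivative 1 / (k y + M)) (at y)" if "-1 < y" "y < P + 1" for y
    using dHw[of y] at_within_Icc_at[of "-1" y "P + 1"] that by auto
  have Hc: "continuous_on {-1..P + 1} H" using dHw by (rule DERIV_continuous_on)
  have Hmono: "H a < H b" if "-1 \<le> a" "a < b" "b \<le> P + 1" for a b
  proof (rule DERIV_pos_imp_increasing_open[OF that(2)])
    show "\<exists>y. (H has_real_derivative y) (at x) \<and> 0 < y" if "a < x" "x < b" for x
      using dH[of x] kM(2)[OF M(1), of x] that \<open>-1 \<le> a\<close> \<open>b \<le> P + 1\<close> by (intro exI[of _ "1 / (k x + M)"]) auto
    show "continuous_on {a..b} H" by (rule continuous_on_subset[OF Hc]) (use that in auto)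
  qed
  have "H 0 = 0" by (simp add: H_def)
  have "H P = 1"
  proof -
    have "integral {-1..0} (\<lambda>y. 1 / (k y + M)) + integral {0..P} (\<lambda>y. 1 / (k y + M)) = integral {-1..P} (\<lambda>y. 1 / (k y + M))"
      using P by (intro Henstock_Kurzweil_Integration.integral_combine integrable_continuous_real fc) auto
    then show ?thesis using M(2) by (simp add: H_def I_def)
  qed
  define g where "g = inv_into {-1..P + 1} H"
  have inj: "inj_on H {-1..P + 1}"
    using Hmono by (intro linorder_inj_onI') (metis atLeastAtMost_iff less_irrefl)
  have gH: "g (H y) = y" if "y \<in> {-1..P + 1}" for y
    unfolding g_def by (rule inv_into_f_f[OF inj that])
  have img: "{H (-1)..H (P + 1)} \<subseteq> H ` {-1..P + 1}"
  proof
    fix x assume "x \<in> {H (-1)..H (P + 1)}"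
    then show "x \<in> H ` {-1..P + 1}" using IVT'[of H "-1" x "P + 1"] Hc P by auto
  qed
  have Hg: "H (g x) = x" "g x \<in> {-1..P + 1}" if "x \<in> {H (-1)..H (P + 1)}" for x
    using that img gH by (auto simp: image_iff subset_iff)
  have "continuous_on (H ` {-1..P + 1}) g"
    by (rule continuous_on_inv[OF Hc]) (use gH in auto)
  then have gc: "continuous_on {H (-1)<..<H (P + 1)} g"
    by (rule continuous_on_subset) (use img in auto)
  have range: "H (-1) < 0" "1 < H (P + 1)"
    using Hmono[of "-1" 0] Hmono[of P "P + 1"] P \<open>H 0 = 0\<close> \<open>H P = 1\<close> by auto
  have g01: "g x \<in> {0..P}" if "x \<in> {0..1}" for x
  proof -
    have x: "x \<in> {H (-1)..H (P + 1)}" using that range by auto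
    note gx = Hg[OF x]
    have "\<not> g x < 0" using Hmono[of "g x" 0] gx that \<open>H 0 = 0\<close> P by auto
    moreover have "\<not> P < g x" using Hmono[of P "g x"] gx that \<open>H P = 1\<close> P by auto
    ultimately show ?thesis by simp
  qed
  have dg: "(g has_real_derivative K (g x) + M) (at x within {0..1})" if x: "x \<in> {0..1}" for x
  proof -
    have xr: "H (-1) < x" "x < H (P + 1)" using x range by auto
    have "(g has_real_derivative inverse (1 / (k (g x) + M))) (at x)"
    proof (rule DERIV_inverse_function[OF _ _ xr])
      show "(H has_real_derivative 1 / (k (g x) + M)) (at (g x))"
        using g01[OF x] P by (intro dH) auto
      show "1 / (k (g x) + M) \<noteq> 0" using kM[OF M(1)] by simp
      show "H (g y) = y" if "H (-1) < y" "y < H (P + 1)" for y using Hg[of y] that by simp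
      show "isCont g x" using gc xr by (simp add: continuous_on_eq_continuous_at)
    qed
    then show ?thesis using kK[OF g01[OF x]] by (auto intro: has_field_derivative_at_within)
  qed
  have dwg: "deriv_within g {0..1} x = K (g x) + M" if "x \<in> {0..1}" for x
    using dg[OF that] that by (intro deriv_within_eqI at_within_unit_interval_nontrivial)
  have "continuous_on {0..1} g" using dg by (rule DERIV_continuous_on)
  then have "continuous_on {0..1} (\<lambda>x. K (g x) + M)"
    by (intro continuous_on_add continuous_on_const continuous_on_compose2[OF K]) auto
  then have "continuous_on {0..1} (deriv_within g {0..1})" by (rule continuous_on_eq) (simp add: dwg)
  moreover have "g differentiable_on {0..1}"
    using dg by (fastforce simp: differentiable_on_def real_differentiable_def)
  moreover have "g 0 = 0" "g 1 = P"
    using gH[of 0] gH[of P] \<open>H 0 = 0\<close> \<open>H P = 1\<close> P by auto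
  ultimately have "steady_state K P g (1 / M)"
    using M0 dwg by (simp add: steady_state_def C1_on_def)
  then show thesis by (rule that)
qed

section \<open>Global existence, uniqueness and exponential convergence\<close>

lemma deriv_le_k_max:
  assumes C2: "C2_real K" and y: "y \<in> {0..P}"
  shows "deriv K y \<le> k_max K P"
proof -
  note K = C2_realD[OF C2]
  have c: "continuous_on S (deriv (deriv K))" for S by (rule continuous_on_subset[OF K(3)]) auto
  have i: "(\<lambda>y. max (deriv (deriv K) y) 0) integrable_on {a..b}" for a b
    by (intro integrable_continuous_real continuous_intros c)
  have "(deriv (deriv K) has_integral (deriv K y - deriv K 0)) {0..y}"
    using y by (intro has_real_integral_derivative) (auto intro: has_field_derivative_at_within[OF K(2)])
  then have "deriv K y - deriv K 0 = integral {0..y} (deriv (deriv K))" by (simp add: integral_unique)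
  also have "\<dots> \<le> integral {0..y} (\<lambda>y. max (deriv (deriv K) y) 0)"
    by (intro integral_le integrable_continuous_real c i) auto
  also have "\<dots> \<le> integral {0..P} (\<lambda>y. max (deriv (deriv K) y) 0)"
    using y by (intro integral_subset_le i) auto
  finally show ?thesis by (simp add: k_max_def)
qed

theorem theorem5p2:
  fixes K :: "real \<Rightarrow> real" and \<Phi>F :: real and Qinit :: "real \<Rightarrow> real"
  assumes "\<Phi>F > 0"
    and "C2_real K"
    and "bounded (range (deriv K))" and "bounded (range (deriv (deriv K)))"
    and "\<forall>\<phi>\<in>{0..\<Phi>F}. K \<phi> > 0"
    and "k_max K \<Phi>F < 0"
    and "integral {0..\<Phi>F} (\<lambda>\<phi>. 1 / K \<phi>) > 1"
    and "C1_on {0..1} Qinit"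
    and "mono_on {0..1} Qinit"
    and "Qinit 0 = 0" and "Qinit 1 = \<Phi>F"
    and "deriv_within Qinit {0..1} 1 > K \<Phi>F"
    and "deriv_within Qinit {0..1} 1 - deriv_within Qinit {0..1} 0 = K \<Phi>F - K 0"
    and "\<forall>\<eta>\<in>{0..1}. deriv_within Qinit {0..1} \<eta> - K (Qinit \<eta>) > 0"
  shows "\<exists>Q N Qs Ns.
    classical_solution K \<Phi>F Qinit \<infinity> Q N \<and>
    (\<forall>Q' N'. classical_solution K \<Phi>F Qinit \<infinity> Q' N' \<longrightarrow>
       (\<forall>\<tau>\<ge>0. N' \<tau> = N \<tau> \<and> (\<forall>\<eta>\<in>{0..1}. Q' \<tau> \<eta> = Q \<tau> \<eta>))) \<and>
    steady_state K \<Phi>F Qs Ns \<and>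
    (\<forall>Qs' Ns'. steady_state K \<Phi>F Qs' Ns' \<longrightarrow>
       Ns' = Ns \<and> (\<forall>\<eta>\<in>{0..1}. Qs' \<eta> = Qs \<eta>)) \<and>
    (\<forall>\<tau>\<ge>0. L1_norm (\<lambda>\<eta>. d_eta Q \<tau> \<eta> - deriv_within Qs {0..1} \<eta>)
       \<le> exp (k_max K \<Phi>F * \<tau>) * L1_norm (\<lambda>\<eta>. d_eta Q 0 \<eta> - deriv_within Qs {0..1} \<eta>))"
proof -
  have P: "0 < \<Phi>F" and C2: "C2_real K" and Kpos: "\<And>y. y \<in> {0..\<Phi>F} \<Longrightarrow> 0 < K y"
    and kneg: "k_max K \<Phi>F < 0"
    using assms by auto
  note K = C2_realD[OF C2]
  obtain L1 where L1: "\<And>x. \<bar>deriv K x\<bar> \<le> L1" using assms(3) by (auto simp: bounded_iff)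
  obtain L2 where L2: "\<And>x. \<bar>deriv (deriv K) x\<bar> \<le> L2" using assms(4) by (auto simp: bounded_iff)
  define u0 where "u0 = deriv_within Qinit {0..1}"
  have u0c: "continuous_on {0..1} u0" using assms(8) by (simp add: C1_on_def u0_def)
  have dQ: "(Qinit has_real_derivative u0 x) (at x within {0..1})" if "x \<in> {0..1}" for x
    unfolding u0_def using assms(8) that by (intro deriv_within_has_real_derivative) (auto simp: C1_on_def)
  have Qi: "integral {0..x} u0 = Qinit x" if "x \<in> {0..1}" for x
  proof -
    have "(u0 has_integral (Qinit x - Qinit 0)) {0..x}"
      by (rule has_real_integral_derivative) (use that in \<open>auto intro!: DERIV_subset[OF dQ]\<close>)
    then show ?thesis using assms(10) by (simp add: integral_unique)
  qed
  obtain u m where u: "\<And>T. slope_solution K (K \<Phi>F - K 0) T u" "\<And>x. x \<in> {0..1} \<Longrightarrow> u 0 x = u0 x"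
    "0 < m" "\<And>t x. 0 \<le> t \<Longrightarrow> x \<in> {0..1} \<Longrightarrow> m \<le> excess K u t x"
    "\<And>t x. 0 \<le> t \<Longrightarrow> x \<in> {0..1} \<Longrightarrow> 0 \<le> u t x" "\<And>t. 0 \<le> t \<Longrightarrow> profile u t 1 = \<Phi>F"
  proof (rule slope_solution_exists[OF K(1,2) L1 L2, of \<Phi>F u0])
    show "0 \<le> K y" if "y \<in> {0..\<Phi>F}" for y using Kpos[OF that] by simp
    show "deriv K y \<le> 0" if "y \<in> {0..\<Phi>F}" for y using deriv_le_k_max[OF C2 that] kneg by simp
    show "u0 1 - u0 0 = K \<Phi>F - K 0" using assms(13) by (simp add: u0_def)
    show "integral {0..1} u0 = \<Phi>F" using Qi[of 1] assms(11) by simp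
    show "0 \<le> u0 x" if "x \<in> {0..1}" for x by (rule deriv_within_nonneg_if_mono[OF dQ[OF that] that assms(9)])
    show "K (integral {0..x} u0) < u0 x" if "x \<in> {0..1}" for x
      using assms(14) that unfolding Qi[OF that] by (auto simp: u0_def)
  qed (use u0c in auto)
  define Q where "Q = profile u"
  define N where "N t = 1 / (u t 1 - K \<Phi>F)" for t
  have sol: "classical_solution K \<Phi>F Qinit \<infinity> Q N"
    unfolding Q_def N_def
  proof (rule classical_solution_of_slope[OF C2 u(1,5)])
    show "K \<Phi>F < u t 1" if "0 \<le> t" for t using u(4)[of t 1] u(3,6) that by (simp add: excess_def)
    show "profile u 0 x = Qinit x" if "x \<in> {0..1}" for x
    proof -
      have "profile u 0 x = integral {0..x} u0" unfolding profile_def using u(2) that by (intro integral_cong) auto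
      then show ?thesis using Qi[OF that] by simp
    qed
  qed
  have unique: "N' t = N t \<and> (\<forall>x\<in>{0..1}. Q' t x = Q t x)"
    if sol': "classical_solution K \<Phi>F Qinit \<infinity> Q' N'" and t: "0 \<le> t" for Q' N' t
  proof -
    have "d_eta Q' 0 x = d_eta Q 0 x" if x: "x \<in> {0..1}" for x
    proof -
      have "d_eta R 0 x = u0 x" if "classical_solution K \<Phi>F Qinit \<infinity> R M" for R M
        unfolding d_eta_def
      proof (intro deriv_within_eqI at_within_unit_interval_nontrivial x)
        show "(R 0 has_real_derivative u0 x) (at x within {0..1})"
          by (rule has_field_derivative_transform_within[OF dQ[OF x], of 1])
            (use that x in \<open>auto simp: classical_solution_def\<close>)
      qed
      from this[OF sol'] this[OF sol] show ?thesis by simp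
    qed
    then have "integral {0..1} (\<lambda>x. \<bar>d_eta Q' 0 x - d_eta Q 0 x\<bar>) = integral {0..1} (\<lambda>x::real. 0)"
      by (intro integral_cong) auto
    then have "integral {0..1} (\<lambda>x. \<bar>d_eta Q' t x - d_eta Q t x\<bar>) \<le> 0"
      using classical_L1_contraction[OF C2 L1 sol' assms(11) sol assms(11) t] by simp
    from classical_solutions_agree[OF C2 L1 sol' assms(11) sol assms(11) t this] show ?thesis by auto
  qed
  have "continuous_on UNIV K" by (rule K_continuous(1)[OF K(1) _ continuous_on_id])
    (use K(2) in \<open>auto intro!: DERIV_continuous_on intro: has_field_derivative_at_within\<close>)
  then obtain Qs Ns where steady: "steady_state K \<Phi>F Qs Ns"
    using steady_state_exists[of K \<Phi>F, OF _ P Kpos assms(7)] by blast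
  have K0: "0 \<le> K 0" using Kpos[of 0] P by simp
  note solS = steady_state_is_classical_solution[OF C2 K0 steady]
  have S1: "Qs 1 = \<Phi>F" using steady by (simp add: steady_state_def)
  have steady_unique: "Ns' = Ns \<and> (\<forall>x\<in>{0..1}. Qs' x = Qs x)" if steady': "steady_state K \<Phi>F Qs' Ns'" for Qs' Ns'
  proof -
    note solS' = steady_state_is_classical_solution[OF C2 K0 steady']
    have S1': "Qs' 1 = \<Phi>F" using steady' by (simp add: steady_state_def)
    define D where "D = integral {0..1} (\<lambda>x. \<bar>d_eta (\<lambda>_. Qs') 0 x - d_eta (\<lambda>_. Qs) 0 x\<bar>)"
    have "d_eta (\<lambda>_. R) 1 = d_eta (\<lambda>_. R) 0" for R by (simp add: d_eta_def fun_eq_iff)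
    then have "D \<le> exp (k_max K \<Phi>F * 1) * D"
      using classical_L1_contraction[OF C2 L1 solS' S1' solS S1, of 1] by (simp add: D_def)
    moreover have "exp (k_max K \<Phi>F * 1) < 1" using kneg by simp
    ultimately have "D \<le> 0" by (smt (verit) mult_less_cancel_right2)
    then have "integral {0..1} (\<lambda>x. \<bar>d_eta (\<lambda>_. Qs') 0 x - d_eta (\<lambda>_. Qs) 0 x\<bar>) \<le> 0" by (simp add: D_def)
    from classical_solutions_agree[OF C2 L1 solS' S1' solS S1 order_refl this] show ?thesis by auto
  qed
  have decay: "L1_norm (\<lambda>x. d_eta Q t x - deriv_within Qs {0..1} x)
      \<le> exp (k_max K \<Phi>F * t) * L1_norm (\<lambda>x. d_eta Q 0 x - deriv_within Qs {0..1} x)" if t: "0 \<le> t" for t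
  proof -
    have e: "d_eta (\<lambda>_. Qs) s x = deriv_within Qs {0..1} x" for s x by (simp add: d_eta_def)
    have "L1_norm (\<lambda>x. d_eta Q s x - deriv_within Qs {0..1} x)
        = integral {0..1} (\<lambda>x. \<bar>d_eta Q s x - d_eta (\<lambda>_. Qs) s x\<bar>)" if "0 \<le> s" for s
      unfolding e[of s, symmetric]
      using d_eta_slice_continuous[OF sol that] d_eta_slice_continuous[OF solS that]
      by (intro L1_norm_continuous continuous_on_diff)
    then show ?thesis
      using classical_L1_contraction[OF C2 L1 sol assms(11) solS S1 t] t by simp
  qed
  show ?thesis
    using sol unique steady steady_unique decay by blast
qed


end
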